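(* Let \((G,\lambda,\mathcal{T})\) be any instance of Time Disjoint Walks in which \(G\) is an oriented star. Then the Central Slot Allocation algorithm described in the context runs in time polynomial in the input size, and, regardless of how ties are broken, its output is a feasible solution that is optimal for min-max Time Disjoint Walks, i.e. it minimizes \(\max_{i\in[k]}(d_i+\lambda(W_i))\) over all feasible solutions.
   Context: Notation: for integers \(a,b\), \([a,b]=\{x\in\mathbb{Z}: a\le x\le b\}\) and \([b]=[1,b]\). Digraphs are finite and have no parallel arcs in the same direction. Let \(G=(V,E)\) be a digraph with arc lengths \(\lambda:E\to\mathbb{Z}_{\ge1}\). A walk from \(u\) to \(v\) is a tuple \(W=(w_1,\dots,w_l)\) of vertices with \(w_1=u\), \(w_l=v\), \((w_i,w_{i+1})\in E\) for all \(i\in[l-1]\) (vertices may repeat). For \(j\in[l]\) let \(\lambda(W,j)=\sum_{i\in[j-1]}\lambda(w_i,w_{i+1})\) and \(\lambda(W)=\lambda(W,l)\). Given delays \(d_1,d_2\in\mathbb{Z}_{\ge0}\) and walks \(W_1,W_2\), the pairs \((d_1,W_1)\) and \((d_2,W_2)\) are time disjoint if for every \(j_1\in[|W_1|]\), \(j_2\in[|W_2|]\) such that the \(j_1\)-th vertex of \(W_1\) equals the \(j_2\)-th vertex of \(W_2\), we have \(d_1+\lambda(W_1,j_1)\ne d_2+\lambda(W_2,j_2)\). Time Disjoint Walks (TDW): an instance is \((G,\lambda,\mathcal{T})\) with \(\mathcal{T}=\{(s_1,t_1),\dots,(s_k,t_k)\}\subseteq V^2\) a set of \(k\) demands across unique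 vertices, such that for each \(i\) there is a walk from \(s_i\) to \(t_i\). A feasible solution is a choice, for each \(i\in[k]\), of a delay \(d_i\in\mathbb{Z}_{\ge0}\) and a walk \(W_i\) from \(s_i\) to \(t_i\), such that the pairs \((d_i,W_i)\) are pairwise time disjoint. Min-sum TDW minimizes \(\sum_{i\in[k]}(d_i+\lambda(W_i))\); min-max TDW minimizes \(\max_{i\in[k]}(d_i+\lambda(W_i))\). An oriented star is a digraph consisting of a central vertex \(x\) and any number of leaves, each joined to \(x\) by a single arc (oriented either way), i.e. an orientation of \(K_{1,n-1}\). Central Slot Allocation algorithm (input an oriented star instance with central vertex \(x\)): for each \(i\in[k]\), let \(W_i=(s_i,x,t_i)\), \(a_i=\lambda(s_i,x)\), \(b_i=\lambda(x,t_i)\); if \(s_i=x\) instead \(W_i=(s_i,t_i)\), \(a_i=0\), \(b_i=\lambda(x,t_i)\), and if \(t_i=x\) instead \(W_i=(s_i,t_i)\), \(a_i=\lambda(s_i,x)\), \(b_i=0\). Set \(U=[k]\) and \(O=\emptyset\). While \(U\neq\emptyset\): let \(m=\min_{i\in U}a_i\); let \(\sigma\) be the least integer \(s\ge m\) with \(s\notin O\); choose \(i^\ast\in\{i\in U: a_i\le\sigma\}\) maximizing \(b_{i^\ast}\) (ties broken arbitrarily); set \(d_{i^\ast}=\sigma-a_{i^\ast}\); remove \(i^\ast\) from \(U\) and add \(\sigma\) to \(O\). Output \(\{(d_i,W_i): i\in[k]\}\). *)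

theory Defs
  imports
    "Graph_Theory.Graph_Theory"
    "HOL-Library.Log_Nat"
    "HOL-Computational_Algebra.Polynomial"
begin

section \<open>Time Disjoint Walks\<close>

text \<open>
  Digraphs without parallel arcs are the pair digraphs of \<open>Graph_Theory\<close>; walks are its vertex walks
  (nonempty vertex lists in which vertices may repeat).  List positions and demand indices start
  at 0, so the \<open>k\<close> demands are \<open>T ! 0, \<dots>, T ! (k - 1)\<close>.
\<close>

definition walk_from_to :: "'v pair_pre_digraph \<Rightarrow> 'v \<Rightarrow> 'v \<Rightarrow> 'v list \<Rightarrow> bool" where
  "walk_from_to G u v W \<longleftrightarrow> vwalk W (with_proj G) \<and> hd W = u \<and> last W = v"

text \<open>The length of the part of \<open>W\<close> that precedes position \<open>j\<close>.\<close>

definition len_upto :: "('v \<times> 'v \<Rightarrow> nat) \<Rightarrow> 'v list \<Rightarrow> nat \<Rightarrow> nat" where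
  "len_upto lam W j = (\<Sum>i<j. lam (W ! i, W ! Suc i))"

definition walk_len :: "('v \<times> 'v \<Rightarrow> nat) \<Rightarrow> 'v list \<Rightarrow> nat" where
  "walk_len lam W = len_upto lam W (length W - 1)"

definition time_disjoint :: "('v \<times> 'v \<Rightarrow> nat) \<Rightarrow> nat \<times> 'v list \<Rightarrow> nat \<times> 'v list \<Rightarrow> bool" where
  "time_disjoint lam p q \<longleftrightarrow>
     (\<forall>i < length (snd p). \<forall>j < length (snd q). snd p ! i = snd q ! j \<longrightarrow>
        fst p + len_upto lam (snd p) i \<noteq> fst q + len_upto lam (snd q) j)"

text \<open>``Demands across unique vertices'': the \<open>2k\<close> endpoints are pairwise distinct.\<close>

locale tdw_instance = pair_fin_digraph G
  for G :: "'v pair_pre_digraph" +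
  fixes lam :: "'v \<times> 'v \<Rightarrow> nat" and T :: "('v \<times> 'v) list"
  assumes lam_pos: "e \<in> parcs G \<Longrightarrow> 1 \<le> lam e"
    and demands_in: "set T \<subseteq> pverts G \<times> pverts G"
    and demands_unique: "distinct (map fst T @ map snd T)"
    and demands_connected: "(s, t) \<in> set T \<Longrightarrow> \<exists>W. walk_from_to G s t W"

definition feasible ::
  "'v pair_pre_digraph \<Rightarrow> ('v \<times> 'v \<Rightarrow> nat) \<Rightarrow> ('v \<times> 'v) list \<Rightarrow> (nat \<times> 'v list) list \<Rightarrow> bool" where
  "feasible G lam T sol \<longleftrightarrow>
     length sol = length T \<and>
     (\<forall>i < length T. walk_from_to G (fst (T ! i)) (snd (T ! i)) (snd (sol ! i))) \<and>
     (\<forall>i < length T. \<forall>j < length T. i \<noteq> j \<longrightarrow> time_disjoint lam (sol ! i) (sol ! j))"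

text \<open>
  For \<open>k = 0\<close> there is only the empty solution, so the unspecified value of \<open>Max {}\<close> is harmless.
\<close>

definition minmax_cost :: "('v \<times> 'v \<Rightarrow> nat) \<Rightarrow> (nat \<times> 'v list) list \<Rightarrow> nat" where
  "minmax_cost lam sol = (MAX i\<in>{..<length sol}. fst (sol ! i) + walk_len lam (snd (sol ! i)))"

definition minmax_optimal ::
  "'v pair_pre_digraph \<Rightarrow> ('v \<times> 'v \<Rightarrow> nat) \<Rightarrow> ('v \<times> 'v) list \<Rightarrow> (nat \<times> 'v list) list \<Rightarrow> bool" where
  "minmax_optimal G lam T sol \<longleftrightarrow>
     feasible G lam T sol \<and>
     (\<forall>sol'. feasible G lam T sol' \<longrightarrow> minmax_cost lam sol \<le> minmax_cost lam sol')"

definition oriented_star :: "'v pair_pre_digraph \<Rightarrow> 'v \<Rightarrow> bool" where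
  "oriented_star G x \<longleftrightarrow>
     x \<in> pverts G \<and>
     (\<forall>(u, v) \<in> parcs G. (u = x) \<noteq> (v = x)) \<and>
     (\<forall>v \<in> pverts G - {x}. ((v, x) \<in> parcs G) \<noteq> ((x, v) \<in> parcs G))"

locale star_instance = tdw_instance G lam T
  for G :: "'v pair_pre_digraph" and lam T +
  fixes x :: 'v
  assumes star: "oriented_star G x"


section \<open>Central Slot Allocation\<close>

definition csa_walk :: "('v \<times> 'v) list \<Rightarrow> 'v \<Rightarrow> nat \<Rightarrow> 'v list" where
  "csa_walk T x i = (let (s, t) = T ! i in if s = x \<or> t = x then [s, t] else [s, x, t])"

definition csa_a :: "('v \<times> 'v \<Rightarrow> nat) \<Rightarrow> ('v \<times> 'v) list \<Rightarrow> 'v \<Rightarrow> nat \<Rightarrow> nat" where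
  "csa_a lam T x i = (let (s, t) = T ! i in if s = x then 0 else lam (s, x))"

definition csa_b :: "('v \<times> 'v \<Rightarrow> nat) \<Rightarrow> ('v \<times> 'v) list \<Rightarrow> 'v \<Rightarrow> nat \<Rightarrow> nat" where
  "csa_b lam T x i = (let (s, t) = T ! i in if t = x then 0 else lam (x, t))"

text \<open>
  One iteration of the main loop on the state \<open>(U, Occ, d)\<close>; the relation is not functional since
  any maximiser may be picked.
\<close>

inductive csa_step ::
  "(nat \<Rightarrow> nat) \<Rightarrow> (nat \<Rightarrow> nat) \<Rightarrow>
   nat set \<times> nat set \<times> (nat \<Rightarrow> nat) \<Rightarrow> nat set \<times> nat set \<times> (nat \<Rightarrow> nat) \<Rightarrow> bool"
  for a b :: "nat \<Rightarrow> nat" where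
  "\<lbrakk> U \<noteq> {}; m = Min (a ` U); \<sigma> = (LEAST s. m \<le> s \<and> s \<notin> Occ);
     i \<in> U; a i \<le> \<sigma>; \<forall>j\<in>U. a j \<le> \<sigma> \<longrightarrow> b j \<le> b i \<rbrakk>
   \<Longrightarrow> csa_step a b (U, Occ, d) (U - {i}, insert \<sigma> Occ, d(i := \<sigma> - a i))"

text \<open>All outputs of the algorithm, over all ways of breaking ties.\<close>

definition csa_outputs ::
  "('v \<times> 'v \<Rightarrow> nat) \<Rightarrow> ('v \<times> 'v) list \<Rightarrow> 'v \<Rightarrow> (nat \<times> 'v list) list set" where
  "csa_outputs lam T x =
     {map (\<lambda>i. (d i, csa_walk T x i)) [0..<length T] | d Occ.
        (csa_step (csa_a lam T x) (csa_b lam T x))\<^sup>*\<^sup>*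
          ({..<length T}, {}, \<lambda>_. 0) ({}, Occ, d)}"


section \<open>A nondeterministic imperative language with logarithmic cost\<close>

text \<open>
  The memory consists of named unbounded arrays of natural numbers, and a scalar is cell 0 of its
  array.  Computing a number is charged its number of binary digits plus one (the logarithmic cost
  criterion for random access machines), and addition and truncated subtraction are the only
  arithmetic operations, so running times are within a polynomial of Turing machine running times.
\<close>

type_synonym 'x mem = "'x \<Rightarrow> nat \<Rightarrow> nat"

datatype 'x exp = Lit nat | Cell 'x "'x exp" (\<open>_ .[_]\<close> [1000, 0] 999)
  | Add "'x exp" "'x exp" | Sub "'x exp" "'x exp"

datatype 'x bexp = Lt "'x exp" "'x exp" | Eq "'x exp" "'x exp"
  | Neg "'x bexp" | Conj "'x bexp" "'x bexp" | Disj "'x bexp" "'x bexp"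

datatype 'x com = Skip
  | Assign 'x "'x exp" "'x exp" (\<open>_ .[_] ::= _\<close> [1000, 0, 61] 61)
  | Seq "'x com" "'x com" (\<open>_;;/ _\<close> [60, 61] 60)
  | Cond "'x bexp" "'x com" "'x com" (\<open>(IF _/ THEN _/ ELSE _)\<close> [0, 0, 61] 61)
  | While "'x bexp" "'x com" (\<open>(WHILE _/ DO _)\<close> [0, 61] 61)
  | Choice "'x com" "'x com"

abbreviation Var :: "'x \<Rightarrow> 'x exp" where
  "Var v \<equiv> v .[Lit 0]"

abbreviation Assign_Var :: "'x \<Rightarrow> 'x exp \<Rightarrow> 'x com" (\<open>_ ::= _\<close> [1000, 61] 61) where
  "v ::= e \<equiv> v .[Lit 0] ::= e"

definition num_cost :: "nat \<Rightarrow> nat" where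
  "num_cost n = 1 + floorlog 2 n"

primrec aval :: "'x exp \<Rightarrow> 'x mem \<Rightarrow> nat" where
  "aval (Lit n) s = n"
| "aval (Cell v e) s = s v (aval e s)"
| "aval (Add e f) s = aval e s + aval f s"
| "aval (Sub e f) s = aval e s - aval f s"

primrec acost :: "'x exp \<Rightarrow> 'x mem \<Rightarrow> nat" where
  "acost (Lit n) s = num_cost n"
| "acost (Cell v e) s = acost e s + num_cost (s v (aval e s))"
| "acost (Add e f) s = acost e s + acost f s + num_cost (aval e s + aval f s)"
| "acost (Sub e f) s = acost e s + acost f s + num_cost (aval e s - aval f s)"

primrec bval :: "'x bexp \<Rightarrow> 'x mem \<Rightarrow> bool" where
  "bval (Lt e f) s \<longleftrightarrow> aval e s < aval f s"
| "bval (Eq e f) s \<longleftrightarrow> aval e s = aval f s"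
| "bval (Neg p) s \<longleftrightarrow> \<not> bval p s"
| "bval (Conj p q) s \<longleftrightarrow> bval p s \<and> bval q s"
| "bval (Disj p q) s \<longleftrightarrow> bval p s \<or> bval q s"

primrec bcost :: "'x bexp \<Rightarrow> 'x mem \<Rightarrow> nat" where
  "bcost (Lt e f) s = 1 + acost e s + acost f s"
| "bcost (Eq e f) s = 1 + acost e s + acost f s"
| "bcost (Neg p) s = 1 + bcost p s"
| "bcost (Conj p q) s = 1 + bcost p s + bcost q s"
| "bcost (Disj p q) s = 1 + bcost p s + bcost q s"

text \<open>
  \<open>step (c, s) n (c', s')\<close>: one small step of cost \<open>n\<close>.  Every step costs at least 1, and \<open>Skip\<close> is
  the only command without a successor.
\<close>

inductive step :: "'x com \<times> 'x mem \<Rightarrow> nat \<Rightarrow> 'x com \<times> 'x mem \<Rightarrow> bool" where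
  Assign: "step (v .[e] ::= f, s) (1 + acost e s + acost f s)
             (Skip, s(v := (s v)(aval e s := aval f s)))"
| Seq_Skip: "step (Skip;; c, s) 1 (c, s)"
| Seq: "step (c, s) n (c', s') \<Longrightarrow> step (c;; c2, s) n (c';; c2, s')"
| Cond_True: "bval p s \<Longrightarrow> step (IF p THEN c ELSE c2, s) (1 + bcost p s) (c, s)"
| Cond_False: "\<not> bval p s \<Longrightarrow> step (IF p THEN c ELSE c2, s) (1 + bcost p s) (c2, s)"
| While_True: "bval p s \<Longrightarrow> step (WHILE p DO c, s) (1 + bcost p s) (c;; WHILE p DO c, s)"
| While_False: "\<not> bval p s \<Longrightarrow> step (WHILE p DO c, s) (1 + bcost p s) (Skip, s)"
| Choice_Left: "step (Choice c c2, s) 1 (c, s)"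
| Choice_Right: "step (Choice c c2, s) 1 (c2, s)"

inductive steps :: "'x com \<times> 'x mem \<Rightarrow> nat \<Rightarrow> 'x com \<times> 'x mem \<Rightarrow> bool" where
  refl: "steps p 0 p"
| step: "steps p n q \<Longrightarrow> step q n' r \<Longrightarrow> steps p (n + n') r"


section \<open>Central Slot Allocation as a program\<close>

text \<open>
  The input is \<open>Centre\<close> and the arrays \<open>Tail\<close>, \<open>Head\<close>, \<open>Len\<close> (of size \<open>NumArcs\<close>) and \<open>Src\<close>, \<open>Dst\<close> (of
  size \<open>NumDemands\<close>).  Walk \<open>i\<close> is returned as the first \<open>WLen[i]\<close> entries of \<open>W0[i], W1[i], W2[i]\<close> and
  its delay as \<open>Delay[i]\<close>.  The set \<open>U\<close> is kept by its indicator \<open>InU\<close> and its cardinality \<open>CardU\<close>, and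
  the set \<open>O\<close> by the list \<open>Occ[0], \<dots>, Occ[NumOcc - 1]\<close>.
\<close>

datatype reg =
    Centre | NumArcs | Tail | Head | Len | NumDemands | Src | Dst
  | W0 | W1 | W2 | WLen | Delay
  | A | B | InU | CardU | Occ | NumOcc | Min_A | Slot | Best | Found | I | J

text \<open>
  All arrays are initially 0 and a star has no loop at its centre, so \<open>A[i]\<close> remains 0 if the source
  is the centre, and \<open>B[i]\<close> remains 0 if the destination is.
\<close>

definition csa_init :: "reg com" where
  "csa_init =
     I ::= Lit 0;;
     WHILE Lt (Var I) (Var NumDemands) DO (
       W0 .[Var I] ::= Src .[Var I];;
       (IF Disj (Eq (Src .[Var I]) (Var Centre)) (Eq (Dst .[Var I]) (Var Centre)) THEN (
         W1 .[Var I] ::= Dst .[Var I];;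
         WLen .[Var I] ::= Lit 2)
       ELSE (
         W1 .[Var I] ::= Var Centre;;
         W2 .[Var I] ::= Dst .[Var I];;
         WLen .[Var I] ::= Lit 3));;
       J ::= Lit 0;;
       WHILE Lt (Var J) (Var NumArcs) DO (
         (IF Conj (Eq (Tail .[Var J]) (Src .[Var I])) (Eq (Head .[Var J]) (Var Centre))
          THEN A .[Var I] ::= Len .[Var J] ELSE Skip);;
         (IF Conj (Eq (Tail .[Var J]) (Var Centre)) (Eq (Head .[Var J]) (Dst .[Var I]))
          THEN B .[Var I] ::= Len .[Var J] ELSE Skip);;
         J ::= Add (Var J) (Lit 1));;
       InU .[Var I] ::= Lit 1;;
       I ::= Add (Var I) (Lit 1));;
     CardU ::= Var NumDemands;;
     NumOcc ::= Lit 0"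

definition csa_min :: "reg com" where
  "csa_min =
     Found ::= Lit 0;;
     I ::= Lit 0;;
     WHILE Lt (Var I) (Var NumDemands) DO (
       (IF Conj (Eq (InU .[Var I]) (Lit 1))
                (Disj (Eq (Var Found) (Lit 0)) (Lt (A .[Var I]) (Var Min_A)))
        THEN (Min_A ::= A .[Var I];; Found ::= Lit 1) ELSE Skip);;
       I ::= Add (Var I) (Lit 1))"

definition csa_slot :: "reg com" where
  "csa_slot =
     Slot ::= Var Min_A;;
     Found ::= Lit 1;;
     WHILE Eq (Var Found) (Lit 1) DO (
       Found ::= Lit 0;;
       J ::= Lit 0;;
       WHILE Lt (Var J) (Var NumOcc) DO (
         (IF Eq (Occ .[Var J]) (Var Slot) THEN Found ::= Lit 1 ELSE Skip);;
         J ::= Add (Var J) (Lit 1));;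
       (IF Eq (Var Found) (Lit 1) THEN Slot ::= Add (Var Slot) (Lit 1) ELSE Skip))"

text \<open>
  On a tie the candidate may or may not be replaced, so that every maximiser can be the one selected.
\<close>

definition csa_best :: "reg com" where
  "csa_best =
     Found ::= Lit 0;;
     I ::= Lit 0;;
     WHILE Lt (Var I) (Var NumDemands) DO (
       (IF Conj (Eq (InU .[Var I]) (Lit 1)) (Neg (Lt (Var Slot) (A .[Var I]))) THEN
         IF Disj (Eq (Var Found) (Lit 0)) (Lt (B .[Var Best]) (B .[Var I]))
         THEN (Best ::= Var I;; Found ::= Lit 1)
         ELSE IF Eq (B .[Var Best]) (B .[Var I])
         THEN Choice (Best ::= Var I) Skip
         ELSE Skip
        ELSE Skip);;
       I ::= Add (Var I) (Lit 1))"

definition csa_prog :: "reg com" where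
  "csa_prog =
     csa_init;;
     WHILE Lt (Lit 0) (Var CardU) DO (
       csa_min;;
       csa_slot;;
       csa_best;;
       Delay .[Var Best] ::= Sub (Var Slot) (A .[Var Best]);;
       InU .[Var Best] ::= Lit 0;;
       CardU ::= Sub (Var CardU) (Lit 1);;
       Occ .[Var NumOcc] ::= Var Slot;;
       NumOcc ::= Add (Var NumOcc) (Lit 1))"

text \<open>
  An encoding of an instance is given by a numbering \<open>nu\<close> of the vertices and an enumeration \<open>es\<close> of
  the arcs.
\<close>

definition encoding :: "'v pair_pre_digraph \<Rightarrow> ('v \<Rightarrow> nat) \<Rightarrow> ('v \<times> 'v) list \<Rightarrow> bool" where
  "encoding G nu es \<longleftrightarrow> inj_on nu (pverts G) \<and> distinct es \<and> set es = parcs G"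

definition csa_input ::
  "('v \<times> 'v \<Rightarrow> nat) \<Rightarrow> ('v \<times> 'v) list \<Rightarrow> 'v \<Rightarrow> ('v \<Rightarrow> nat) \<Rightarrow> ('v \<times> 'v) list \<Rightarrow>
   (reg \<times> nat list) list" where
  "csa_input lam T x nu es =
     [(Centre, [nu x]),
      (NumArcs, [length es]),
      (Tail, map (nu \<circ> fst) es),
      (Head, map (nu \<circ> snd) es),
      (Len, map lam es),
      (NumDemands, [length T]),
      (Src, map (nu \<circ> fst) T),
      (Dst, map (nu \<circ> snd) T)]"

definition input_size :: "('x \<times> nat list) list \<Rightarrow> nat" where
  "input_size inp = (\<Sum>(v, ns)\<leftarrow>inp. \<Sum>n\<leftarrow>ns. num_cost n)"

definition load :: "('x \<times> nat list) list \<Rightarrow> 'x mem" where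
  "load inp v i =
     (case map_of inp v of None \<Rightarrow> 0 | Some ns \<Rightarrow> if i < length ns then ns ! i else 0)"

definition read_output :: "nat \<Rightarrow> reg mem \<Rightarrow> (nat \<times> nat list) list" where
  "read_output k s =
     map (\<lambda>i. (s Delay i, take (s WLen i) [s W0 i, s W1 i, s W2 i])) [0..<k]"

end

theory Submission
  imports Defs
begin

text \<open>
  In an oriented star the walk of each demand is forced and two walks meet only at the centre, so a
  solution amounts to an injective assignment of slots \<open>f i = d i + a i \<ge> a i\<close> with cost
  \<open>Max (f i + b i)\<close>: single-machine scheduling of unit jobs with release dates \<open>a\<close> and tails \<open>b\<close>.
  Any such schedule can be turned, one iteration at a time and without increasing its cost, into the
  one computed by the algorithm: if the demand \<open>i\<close> selected for slot \<open>\<sigma>\<close> is scheduled elsewhere, it is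
  later than \<open>\<sigma>\<close>, and it can be swapped with the occupant of \<open>\<sigma>\<close>, whose tail is at most \<open>b i\<close>.

  For the program, at most as many slots are probed in an iteration as are occupied, plus one, so the
  number of steps is polynomial in the numbers of demands and arcs.
\<close>

section \<open>Executions of programs\<close>

text \<open>Arc lengths may be exponential in the input size, so no loop may be bounded by the value
  of a number. The search for a slot is harmless because every slot it skips is occupied, and
  pigeonhole then bounds the distance from the least release date \<open>m\<close> to \<sigma>. The
  same fact drives the exchange: a demand not yet selected is released at \<open>m\<close> or later,
  and all slots from \<open>m\<close> to \<sigma> - 1 belong to demands already fixed, so it cannot
  sit before \<sigma>. The displaced occupant of \<sigma> therefore moves to a later slot, where it
  is still released, and its smaller tail is covered by the bound that the selected demand met in
  that slot. Costs are kept out of the reasoning about the program. \<open>stp\<close> forgets them,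
  only steps are counted, and one general argument turns \<open>N\<close> steps on an input of size
  \<open>L\<close> into a cost of order \<open>N * (L + N)\<close>, with a factor that depends on
  the fixed program alone.\<close>

definition stp :: "'x com \<times> 'x mem \<Rightarrow> 'x com \<times> 'x mem \<Rightarrow> bool" where
  "stp p q \<longleftrightarrow> (\<exists>n. step p n q)"

inductive_cases step_elims:
  "step (Skip, s) n q" "step (v .[e] ::= f, s) n q" "step (c;; d, s) n q"
  "step (IF p THEN c ELSE d, s) n q" "step (WHILE p DO c, s) n q" "step (Choice c d, s) n q"

lemma stp_iff:
  "stp (Skip, s) q \<longleftrightarrow> False"
  "stp (v .[e] ::= f, s) q \<longleftrightarrow> q = (Skip, s(v := (s v)(aval e s := aval f s)))"
  "stp (c;; d, s) q \<longleftrightarrow>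
     (c = Skip \<and> q = (d, s)) \<or> (\<exists>c' s'. stp (c, s) (c', s') \<and> q = (c';; d, s'))"
  "stp (IF p THEN c ELSE d, s) q \<longleftrightarrow> q = (if bval p s then c else d, s)"
  "stp (WHILE p DO c, s) q \<longleftrightarrow> q = (if bval p s then c;; WHILE p DO c else Skip, s)"
  "stp (Choice c d, s) q \<longleftrightarrow> q = (c, s) \<or> q = (d, s)"
proof -
  show "stp (c;; d, s) q \<longleftrightarrow>
     (c = Skip \<and> q = (d, s)) \<or> (\<exists>c' s'. stp (c, s) (c', s') \<and> q = (c';; d, s'))"
    unfolding stp_def by (blast elim: step_elims intro: step.intros)
qed (auto simp: stp_def elim: step_elims intro: step.intros)

text \<open>Expressions are total and every guard has a step for either outcome, so only
  \<open>Skip\<close> is final. Because of this, \<open>ok\<close> cannot hold vacuously and yields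
  \<open>can\<close>.\<close>

lemma stp_progress: "c \<noteq> Skip \<Longrightarrow> \<exists>q. stp (c, s) q"
proof (induction c)
  case (Seq c d)
  then show ?case by (cases "c = Skip") (force simp: stp_iff)+
qed (auto simp: stp_iff)

text \<open>
  \<open>ok Q n c s\<close>: every execution of \<open>c\<close> from \<open>s\<close> ends within \<open>n\<close> steps, in a state satisfying \<open>Q\<close>;
  \<open>can Q c s\<close>: some execution ends in such a state.  The first is used for deterministic parts and
  for soundness, the second to show that every way of breaking ties is realised.
\<close>

primrec ok :: "('x mem \<Rightarrow> bool) \<Rightarrow> nat \<Rightarrow> 'x com \<Rightarrow> 'x mem \<Rightarrow> bool" where
  "ok Q 0 c s \<longleftrightarrow> c = Skip \<and> Q s"
| "ok Q (Suc n) c s \<longleftrightarrow> (c = Skip \<longrightarrow> Q s) \<and> (\<forall>c' s'. stp (c, s) (c', s') \<longrightarrow> ok Q n c' s')"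

definition can :: "('x mem \<Rightarrow> bool) \<Rightarrow> 'x com \<Rightarrow> 'x mem \<Rightarrow> bool" where
  "can Q c s \<longleftrightarrow> (\<exists>t. stp\<^sup>*\<^sup>* (c, s) (Skip, t) \<and> Q t)"

lemma ok_Skip: "Q s \<Longrightarrow> ok Q n Skip s"
  by (cases n) (auto simp: stp_iff)

lemma ok_mono: "ok Q n c s \<Longrightarrow> n \<le> m \<Longrightarrow> (\<And>t. Q t \<Longrightarrow> Q' t) \<Longrightarrow> ok Q' m c s"
proof (induction n arbitrary: m c s)
  case 0
  then show ?case by (auto intro: ok_Skip)
next
  case (Suc n)
  then obtain m' where m: "m = Suc m'" "n \<le> m'" by (cases m) auto
  have "ok Q' m' c' s'" if "stp (c, s) (c', s')" for c' s'
    using that Suc.prems(1) by (intro Suc.IH[OF _ m(2) Suc.prems(3)]) auto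
  with Suc.prems(1,3) show ?case by (simp add: m)
qed

text \<open>Turns the recursive budget into a statement about actual runs. The end \<open>c'\<close>
  is arbitrary because the cost claim also ranges over unfinished executions.\<close>

lemma ok_run:
  "(stp ^^ m) (c, s) (c', s') \<Longrightarrow> ok Q n c s \<Longrightarrow> m \<le> n \<and> (c' = Skip \<longrightarrow> Q s')"
proof (induction m arbitrary: n c s)
  case 0
  then show ?case by (cases n) auto
next
  case (Suc m)
  from relpowp_Suc_D2[OF Suc.prems(1)] obtain d t
    where d: "stp (c, s) (d, t)" "(stp ^^ m) (d, t) (c', s')" by auto
  then obtain n' where "n = Suc n'" "ok Q n' d t"
    using Suc.prems(2) by (cases n) (auto simp: stp_iff)
  with Suc.IH[OF d(2)] show ?case by auto
qed

lemma can_if_ok: "ok Q n c s \<Longrightarrow> can Q c s"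
proof (induction n arbitrary: c s)
  case (Suc n)
  show ?case
  proof (cases "c = Skip")
    case False
    then obtain d t where d: "stp (c, s) (d, t)" using stp_progress by fast
    with Suc have "can Q d t" by auto
    with d show ?thesis unfolding can_def by (meson converse_rtranclp_into_rtranclp)
  qed (use Suc.prems in \<open>auto simp: can_def\<close>)
qed (auto simp: can_def)

lemma can_mono: "can Q c s \<Longrightarrow> (\<And>t. Q t \<Longrightarrow> Q' t) \<Longrightarrow> can Q' c s"
  unfolding can_def by auto

lemma can_stp: "stp (c, s) (d, t) \<Longrightarrow> can Q d t \<Longrightarrow> can Q c s"
  unfolding can_def by (meson converse_rtranclp_into_rtranclp)

text \<open>The additional step is \<open>Seq_Skip\<close>, which discards the finished first
  command.\<close>

lemma ok_Seq:
  assumes "ok P n c s" and "\<And>t. P t \<Longrightarrow> ok Q m d t"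
  shows "ok Q (Suc (n + m)) (c;; d) s"
  using assms(1)
proof (induction n arbitrary: c s)
  case 0
  then show ?case using assms(2) by (auto simp: stp_iff)
next
  case (Suc n)
  have "ok Q (Suc (n + m)) c' s'" if st: "stp (c;; d, s) (c', s')" for c' s'
    using st unfolding stp_iff(3)
  proof (elim disjE exE conjE)
    assume "c = Skip" "(c', s') = (d, s)"
    moreover have "ok Q (Suc (n + m)) d s"
      using Suc.prems \<open>c = Skip\<close> by (intro ok_mono[OF assms(2)]) auto
    ultimately show ?thesis by (simp del: ok.simps)
  next
    fix e t assume "stp (c, s) (e, t)" "(c', s') = (e;; d, t)"
    then show ?thesis using Suc by auto
  qed
  then show ?case by simp
qed

lemma stps_Seq: "stp\<^sup>*\<^sup>* (c, s) (c', t) \<Longrightarrow> stp\<^sup>*\<^sup>* (c;; d, s) (c';; d, t)"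
proof (induction "(c, s)" arbitrary: c s rule: converse_rtranclp_induct)
  case (step q)
  obtain e u where q: "q = (e, u)" by fastforce
  have "stp (c;; d, s) (e;; d, u)" using step.hyps(1) by (simp add: stp_iff q)
  then show ?case using step.hyps(3)[OF q] by (rule converse_rtranclp_into_rtranclp)
qed auto

lemma can_Seq:
  assumes "can P c s" and "\<And>t. P t \<Longrightarrow> can Q d t"
  shows "can Q (c;; d) s"
proof -
  from assms(1) obtain t where t: "stp\<^sup>*\<^sup>* (c, s) (Skip, t)" "P t" by (auto simp: can_def)
  from stps_Seq[OF t(1)] have "stp\<^sup>*\<^sup>* (c;; d, s) (Skip;; d, t)" .
  also have "stp (Skip;; d, t) (d, t)" by (simp add: stp_iff)
  finally show ?thesis
    using assms(2)[OF t(2)] unfolding can_def by (meson rtranclp_trans)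
qed

text \<open>\<open>P i\<close> describes the state after \<open>i\<close> passes. A pass pays
  \<open>n\<close> for the body, one for the guard and one for \<open>Seq_Skip\<close>; the final
  \<open>+ 1\<close> is the failing guard. No counter register is required, so a loop controlled by
  a flag fits as well once its number of passes is known.\<close>

lemma ok_for:
  assumes "P 0 s"
    and "\<And>i t. P i t \<Longrightarrow> i \<le> k \<Longrightarrow> bval b t \<longleftrightarrow> i < k"
    and "\<And>i t. P i t \<Longrightarrow> i < k \<Longrightarrow> ok (P (Suc i)) n c t"
  shows "ok (P k) (k * (n + 2) + 1) (WHILE b DO c) s"
proof -
  have "ok (P k) (j * (n + 2) + 1) (WHILE b DO c) t" if "P i t" "i + j = k" for i j t
    using that
  proof (induction j arbitrary: i t)
    case 0
    then show ?case using assms(2)[of i t] by (auto simp: stp_iff)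
  next
    case (Suc j)
    have "ok (P k) (Suc (n + (j * (n + 2) + 1))) (c;; WHILE b DO c) t"
      using Suc.prems by (intro ok_Seq[of "P (Suc i)"] assms(3) Suc.IH) auto
    then show ?case using assms(2)[of i t] Suc.prems by (auto simp: stp_iff ac_simps)
  qed
  from this[of 0 s k] assms(1) show ?thesis by simp
qed

lemma can_while_step:
  assumes "bval b s" "can P c s" "\<And>t. P t \<Longrightarrow> can Q (WHILE b DO c) t"
  shows "can Q (WHILE b DO c) s"
  by (rule can_stp[OF _ can_Seq[OF assms(2,3)]]) (use assms(1) in \<open>auto simp: stp_iff\<close>)

lemma can_while_end: "\<not> bval b s \<Longrightarrow> Q s \<Longrightarrow> can Q (WHILE b DO c) s"
  by (rule can_stp[of _ s Skip s]) (auto simp: stp_iff can_def)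

lemma can_for:
  assumes "P 0 s"
    and "\<And>i t. P i t \<Longrightarrow> i \<le> k \<Longrightarrow> bval b t \<longleftrightarrow> i < k"
    and "\<And>i t. P i t \<Longrightarrow> i < k \<Longrightarrow> can (P (Suc i)) c t"
  shows "can (P k) (WHILE b DO c) s"
proof -
  have "can (P k) (WHILE b DO c) t" if "P i t" "i + j = k" for i j t
    using that
  proof (induction j arbitrary: i t)
    case 0
    then show ?case using assms(2)[of i t] by (intro can_while_end) auto
  next
    case (Suc j)
    then show ?case using assms(2)[of i t] 
      by (intro can_while_step[of b t "P (Suc i)"] assms(3) Suc.IH) auto
  qed
  from this[of 0 s k] assms(1) show ?thesis by simp
qed

section \<open>Loop-free code by symbolic execution\<close>

primrec loopfree :: "'x com \<Rightarrow> bool" where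
  "loopfree Skip \<longleftrightarrow> True"
| "loopfree (v .[e] ::= f) \<longleftrightarrow> True"
| "loopfree (c;; d) \<longleftrightarrow> loopfree c \<and> loopfree d"
| "loopfree (IF b THEN c ELSE d) \<longleftrightarrow> loopfree c \<and> loopfree d"
| "loopfree (WHILE b DO c) \<longleftrightarrow> False"
| "loopfree (Choice c d) \<longleftrightarrow> loopfree c \<and> loopfree d"

text \<open>The values of \<open>results\<close> and \<open>nsteps\<close> on loops are junk: both are only used under \<open>loopfree\<close>.\<close>

primrec results :: "'x com \<Rightarrow> 'x mem \<Rightarrow> 'x mem set" where
  "results Skip s = {s}"
| "results (v .[e] ::= f) s = {s(v := (s v)(aval e s := aval f s))}"
| "results (c;; d) s = (\<Union>t\<in>results c s. results d t)"
| "results (IF b THEN c ELSE d) s = (if bval b s then results c s else results d s)"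
| "results (WHILE b DO c) s = {}"
| "results (Choice c d) s = results c s \<union> results d s"

primrec nsteps :: "'x com \<Rightarrow> nat" where
  "nsteps Skip = 0"
| "nsteps (v .[e] ::= f) = 1"
| "nsteps (c;; d) = Suc (nsteps c + nsteps d)"
| "nsteps (IF b THEN c ELSE d) = Suc (nsteps c + nsteps d)"
| "nsteps (WHILE b DO c) = 0"
| "nsteps (Choice c d) = Suc (nsteps c + nsteps d)"

text \<open>Reduces straight-line code to a check of its final states. \<open>nsteps\<close> adds up
  both branches of a conditional, an overestimate that makes the budget independent of the
  state.\<close>

lemma ok_loopfree:
  assumes "loopfree c" "\<And>t. t \<in> results c s \<Longrightarrow> Q t"
  shows "ok Q (nsteps c) c s"
  using assms
proof (induction c arbitrary: s Q)
  case (Seq c d)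
  have "ok (\<lambda>t. t \<in> results c s) (nsteps c) c s" using Seq.prems by (intro Seq.IH) auto
  then have "ok Q (Suc (nsteps c + nsteps d)) (c;; d) s"
    by (rule ok_Seq) (use Seq.prems in \<open>auto intro: Seq.IH(2)\<close>)
  then show ?case by simp
next
  case (Cond b c d)
  show ?case
  proof (cases "bval b s")
    case True
    with Cond.prems Cond.IH(1)[of s Q] have "ok Q (nsteps c) c s" by simp
    with True show ?thesis by (auto simp: stp_iff elim: ok_mono)
  next
    case False
    with Cond.prems Cond.IH(2)[of s Q] have "ok Q (nsteps d) d s" by simp
    with False show ?thesis by (auto simp: stp_iff elim: ok_mono)
  qed
next
  case (Choice c d)
  have "ok Q (nsteps c) c s" "ok Q (nsteps d) d s" using Choice by auto
  then show ?case by (auto simp: stp_iff elim: ok_mono)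
qed (auto simp: stp_iff)

lemma can_loopfree: "loopfree c \<Longrightarrow> t \<in> results c s \<Longrightarrow> Q t \<Longrightarrow> can Q c s"
proof (induction c arbitrary: s t Q)
  case (Seq c d)
  then obtain u where u: "u \<in> results c s" "t \<in> results d u" by auto
  have "can (\<lambda>v. v = u) c s" using Seq.prems u(1) by (intro Seq.IH(1)[of u]) auto
  moreover have "can Q d u" using Seq.prems u(2) by (intro Seq.IH(2)[of t]) auto
  ultimately show ?case by (auto intro: can_Seq)
next
  case (Cond b c d)
  then have "can Q (if bval b s then c else d) s" by (auto split: if_splits)
  then show ?case by (rule can_stp[rotated]) (simp add: stp_iff)
next
  case (Choice c d)
  then have "can Q c s \<or> can Q d s" by auto
  moreover have "stp (Choice c d, s) (c, s)" "stp (Choice c d, s) (d, s)"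
    by (simp_all add: stp_iff)
  ultimately show ?case by (blast intro: can_stp)
next
  case (Assign v e f)
  show ?case by (rule can_stp[of _ s Skip t]) (use Assign in \<open>auto simp: stp_iff can_def simp del: fun_upd_apply\<close>)
qed (auto simp: can_def)

section \<open>The logarithmic cost of an execution\<close>

text \<open>
  One step multiplies the largest cell by at most a constant factor, so \<open>m\<close> steps add \<open>O(m)\<close> digits,
  and a bound on the number of steps that is polynomial in the input size bounds the cost as well.
\<close>

primrec exp_size :: "'x exp \<Rightarrow> nat" where
  "exp_size (Lit n) = n + 1"
| "exp_size (Cell v e) = exp_size e + 1"
| "exp_size (Add e f) = exp_size e + exp_size f + 1"
| "exp_size (Sub e f) = exp_size e + exp_size f + 1"

primrec bexp_size :: "'x bexp \<Rightarrow> nat" where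
  "bexp_size (Lt e f) = exp_size e + exp_size f + 1"
| "bexp_size (Eq e f) = exp_size e + exp_size f + 1"
| "bexp_size (Neg p) = bexp_size p + 1"
| "bexp_size (Conj p q) = bexp_size p + bexp_size q + 1"
| "bexp_size (Disj p q) = bexp_size p + bexp_size q + 1"

primrec max_exp_size :: "'x com \<Rightarrow> nat" where
  "max_exp_size Skip = 0"
| "max_exp_size (v .[e] ::= f) = exp_size e + exp_size f + 1"
| "max_exp_size (c;; d) = max (max_exp_size c) (max_exp_size d)"
| "max_exp_size (IF b THEN c ELSE d) = max (bexp_size b) (max (max_exp_size c) (max_exp_size d))"
| "max_exp_size (WHILE b DO c) = max (bexp_size b) (max_exp_size c)"
| "max_exp_size (Choice c d) = max (max_exp_size c) (max_exp_size d)"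

lemma num_cost_le: "n \<le> 2 ^ h \<Longrightarrow> num_cost n \<le> h + 2"
proof -
  assume "n \<le> 2 ^ h"
  also have "(2::nat) ^ h < 2 ^ (h + 1)" by simp
  finally have "floorlog 2 n \<le> h + 1" by (rule floorlog_leI) auto
  then show ?thesis by (simp add: num_cost_def)
qed

lemma le_power_num_cost: "n \<le> 2 ^ num_cost n"
proof (cases "n = 0")
  case False
  then have "n < 2 ^ floorlog 2 n" using floorlog_bounds[of n 2] by auto
  also have "\<dots> \<le> 2 ^ num_cost n" unfolding num_cost_def by (rule power_increasing) auto
  finally show ?thesis by (rule less_imp_le)
qed simp

text \<open>Each node of an expression adds at most one to the exponent, since an addition at most
  doubles the larger bound. A literal counts \<open>n + 1\<close> in \<open>exp_size\<close> so that
  \<open>n < 2 ^ n\<close> covers it.\<close>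

lemma aval_le:
  assumes "\<And>v i. s v i \<le> 2 ^ h"
  shows "aval e s \<le> 2 ^ (h + exp_size e)"
proof (induction e)
  case (Lit n)
  have "n < 2 ^ n" by (rule less_exp)
  also have "(2::nat) ^ n \<le> 2 ^ (h + exp_size (Lit n))" by (intro power_increasing) auto
  finally show ?case unfolding aval.simps by (rule less_imp_le)
next
  case (Cell v e)
  have "(2::nat) ^ h \<le> 2 ^ (h + exp_size (v .[e]))" by (rule power_increasing) auto
  then show ?case using assms[of v "aval e s"] unfolding aval.simps by (rule order.trans[rotated])
next
  case (Add e f)
  have "aval e s \<le> 2 ^ (h + exp_size e + exp_size f)" "aval f s \<le> 2 ^ (h + exp_size e + exp_size f)"
    using Add by (auto elim!: order.trans intro!: power_increasing)
  then show ?case by (simp add: add.assoc)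
next
  case (Sub e f)
  have "aval e s \<le> 2 ^ (h + exp_size e + exp_size f + 1)"
    using Sub(1) by (auto elim!: order.trans simp del: power_Suc intro!: power_increasing)
  then show ?case by (simp add: add.assoc)
qed

text \<open>Every node costs at most \<open>h + g + 2\<close>. The bound \<open>g\<close> is kept
  apart from \<open>exp_size e\<close> so that the induction hypotheses for subexpressions share
  this factor and simply add up.\<close>

lemma acost_le:
  assumes "\<And>v i. s v i \<le> 2 ^ h" and "exp_size e \<le> g"
  shows "acost e s \<le> exp_size e * (h + g + 2)"
  using assms(2)
proof (induction e)
  case (Lit n)
  have "num_cost n \<le> h + (n + 1) + 2"
    using num_cost_le[OF aval_le[of s h "Lit n", OF assms(1)]] by simp
  with Lit show ?case by (simp add: algebra_simps)
next
  case (Cell v e)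
  have "num_cost (s v (aval e s)) \<le> h + 2" by (intro num_cost_le assms(1))
  with Cell show ?case by (simp add: algebra_simps)
next
  case (Add e f)
  have "num_cost (aval (Add e f) s) \<le> h + exp_size (Add e f) + 2"
    by (intro num_cost_le aval_le assms(1))
  with Add show ?case by (simp add: algebra_simps)
next
  case (Sub e f)
  have "num_cost (aval (Sub e f) s) \<le> h + exp_size (Sub e f) + 2"
    by (intro num_cost_le aval_le assms(1))
  with Sub show ?case by (simp add: algebra_simps)
qed

lemma bcost_le:
  assumes "\<And>v i. s v i \<le> 2 ^ h" and "bexp_size b \<le> g"
  shows "bcost b s \<le> bexp_size b * (h + g + 2)"
  using assms(2)
proof (induction b)
  case (Lt e f)
  then show ?case using acost_le[of s h e g, OF assms(1)] acost_le[of s h f g, OF assms(1)]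
    by (simp add: algebra_simps)
next
  case (Eq e f)
  then show ?case using acost_le[of s h e g, OF assms(1)] acost_le[of s h f g, OF assms(1)]
    by (simp add: algebra_simps)
qed (simp_all add: algebra_simps)

text \<open>Unfolding a loop or entering a branch creates no new expressions, so \<open>g\<close>
  stays fixed along a run; only the exponent \<open>h\<close> moves, by at most \<open>g\<close> per
  step.\<close>

lemma step_growth:
  assumes "step (c, s) n (c', s')" "max_exp_size c \<le> g" "\<And>v i. s v i \<le> 2 ^ h"
  shows "max_exp_size c' \<le> g \<and> (\<forall>v i. s' v i \<le> 2 ^ (h + g)) \<and> n \<le> 1 + g * (h + g + 2)"
proof -
  have up: "s v i \<le> 2 ^ (h + g)" for v i
    using assms(3)[of v i] by (rule order.trans) (simp add: power_increasing)
  have cond: "bcost b s \<le> g + (g + g * (h + g))" if "bexp_size b \<le> g" for b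
    using bcost_le[of s h, OF assms(3) that] mult_le_mono1[OF that, of "h + g + 2"] by simp
  show ?thesis
    using assms(1,2) up
  proof (induction "(c, s)" n "(c', s')" arbitrary: c c' s' rule: step.induct)
    case (Assign v e f)
    have "aval f s \<le> 2 ^ (h + exp_size f)" by (rule aval_le[of s h, OF assms(3)])
    also have "\<dots> \<le> 2 ^ (h + g)" using Assign by (intro power_increasing) auto
    finally have "aval f s \<le> 2 ^ (h + g)" .
    moreover have "acost e s + acost f s \<le> (exp_size e + exp_size f) * (h + g + 2)"
      using acost_le[of s h e g, OF assms(3)] acost_le[of s h f g, OF assms(3)] Assign(1)
      by (simp add: algebra_simps)
    moreover have "(exp_size e + exp_size f) * (h + g + 2) \<le> g * (h + g + 2)"
      using Assign(1) by (intro mult_le_mono1) simp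
    ultimately show ?case using Assign by auto
  qed (auto intro: cond)
qed

text \<open>During \<open>m\<close> steps the exponent never exceeds \<open>h + m * g\<close>, so
  every step can be charged the same worst case. This makes the total quadratic in
  \<open>m\<close>.\<close>

lemma steps_growth:
  assumes "steps (c, s) n (c', s')" "max_exp_size c \<le> g" "\<And>v i. s v i \<le> 2 ^ h"
  shows "\<exists>m. (stp ^^ m) (c, s) (c', s') \<and> max_exp_size c' \<le> g \<and>
           (\<forall>v i. s' v i \<le> 2 ^ (h + m * g)) \<and> n \<le> m * (1 + g * (h + m * g + g + 2))"
  using assms
proof (induction "(c, s)" n "(c', s')" arbitrary: c' s' rule: steps.induct)
  case refl
  then show ?case by (intro exI[of _ 0]) auto
next
  case (step n q n' c' s')
  obtain d t where q: "q = (d, t)" by fastforce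
  from step.hyps(2)[OF q step.prems] obtain m where m: "(stp ^^ m) (c, s) (d, t)"
    "max_exp_size d \<le> g" "\<And>v i. t v i \<le> 2 ^ (h + m * g)"
    "n \<le> m * (1 + g * (h + m * g + g + 2))" by blast
  from step_growth[OF step.hyps(3)[unfolded q] m(2,3)]
  have *: "max_exp_size c' \<le> g" "\<forall>v i. s' v i \<le> 2 ^ (h + m * g + g)"
    "n' \<le> 1 + g * (h + m * g + g + 2)" by auto
  have "(stp ^^ Suc m) (c, s) (c', s')"
    using m(1) step.hyps(3) unfolding q stp_def by (auto intro: relcomppI)
  moreover have "n + n' \<le> Suc m * (1 + g * (h + Suc m * g + g + 2))"
  proof -
    have "n + n' \<le> Suc m * (1 + g * (h + m * g + g + 2))" using m(4) *(3) by simp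
    also have "\<dots> \<le> Suc m * (1 + g * (h + Suc m * g + g + 2))"
      by (intro mult_le_mono2 add_le_mono) auto
    finally show ?thesis .
  qed
  moreover have "\<forall>v i. s' v i \<le> 2 ^ (h + Suc m * g)" using *(2) by (simp add: ac_simps)
  ultimately show ?case using *(1) by blast
qed

lemma steps_iff_stps: "(\<exists>n. steps p n q) \<longleftrightarrow> stp\<^sup>*\<^sup>* p q"
proof
  assume "\<exists>n. steps p n q"
  then obtain n where "steps p n q" ..
  then show "stp\<^sup>*\<^sup>* p q"
  proof induction
    case (step p n q n' r)
    then have "stp q r" by (auto simp: stp_def)
    with step.IH show ?case by (rule rtranclp.rtrancl_into_rtrancl)
  qed auto
next
  assume "stp\<^sup>*\<^sup>* p q"
  then show "\<exists>n. steps p n q"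
  proof induction
    case (step q r)
    then obtain n n' where "steps p n q" "step q n' r" by (auto simp: stp_def)
    then have "steps p (n + n') r" by (rule steps.step)
    then show ?case ..
  qed (auto intro: steps.refl)
qed

lemma steps_cost_le:
  assumes "ok Q N c s" "max_exp_size c \<le> g" "\<And>v i. s v i \<le> 2 ^ h"
    and "steps (c, s) n (c', s')"
  shows "n \<le> N * (1 + g * (h + N * g + g + 2))"
proof -
  obtain m where m: "(stp ^^ m) (c, s) (c', s')" "n \<le> m * (1 + g * (h + m * g + g + 2))"
    using steps_growth[OF assms(4,2,3)] by blast
  have "m \<le> N" using ok_run[OF m(1) assms(1)] by simp
  then have "m * (1 + g * (h + m * g + g + 2)) \<le> N * (1 + g * (h + N * g + g + 2))"
    by (intro mult_le_mono add_le_mono) auto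
  with m(2) show ?thesis by simp
qed

lemma ok_final:
  assumes "ok Q N c s" "steps (c, s) n (Skip, t)"
  shows "Q t"
proof -
  have "stp\<^sup>*\<^sup>* (c, s) (Skip, t)" using assms(2) steps_iff_stps by blast
  then obtain m where "(stp ^^ m) (c, s) (Skip, t)" by (auto simp: rtranclp_power)
  from ok_run[OF this assms(1)] show ?thesis by simp
qed

section \<open>The parts of an iteration\<close>

text \<open>A frame condition by whole arrays: it lets arrays that a piece of code leaves alone be
  read back from its starting state.\<close>

definition agree_off :: "'x set \<Rightarrow> 'x mem \<Rightarrow> 'x mem \<Rightarrow> bool" where
  "agree_off X s t \<longleftrightarrow> (\<forall>r. r \<notin> X \<longrightarrow> t r = s r)"

lemma agree_offD: "agree_off X s t \<Longrightarrow> r \<notin> X \<Longrightarrow> t r = s r"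
  by (simp add: agree_off_def)

lemma agree_off_refl [simp]: "agree_off X s s"
  by (simp add: agree_off_def)

lemma agree_off_upd [simp]: "agree_off X s t \<Longrightarrow> v \<in> X \<Longrightarrow> agree_off X s (t(v := f))"
  by (simp add: agree_off_def)

text \<open>Backward reasoning: the postcondition is pulled through \<open>d\<close> symbolically,
  which leaves an obligation on \<open>c\<close> alone.\<close>

lemma ok_Seq_loopfree:
  assumes "loopfree d" "ok (\<lambda>t. \<forall>u\<in>results d t. Q u) n c s"
  shows "ok Q (Suc (n + nsteps d)) (c;; d) s"
  using assms(2) by (rule ok_Seq) (auto intro: ok_loopfree assms(1))

lemma can_Seq_loopfree:
  assumes "loopfree d" "can (\<lambda>t. \<exists>u\<in>results d t. Q u) c s"
  shows "can Q (c;; d) s"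
  using assms(2) by (rule can_Seq) (auto intro: can_loopfree assms(1))

lemma Int_lessThan_Suc:
  "U \<inter> {..<Suc i} = (if i \<in> U then insert i (U \<inter> {..<i}) else U \<inter> {..<i})"
  by (auto simp: less_Suc_eq)

section \<open>The least release date among the remaining demands\<close>

definition csa_min_body :: "reg com" where
  "csa_min_body =
     (IF Conj (Eq (InU .[Var I]) (Lit 1))
              (Disj (Eq (Var Found) (Lit 0)) (Lt (A .[Var I]) (Var Min_A)))
      THEN (Min_A ::= A .[Var I];; Found ::= Lit 1) ELSE Skip);;
     I ::= Add (Var I) (Lit 1)"

lemma csa_min_body_results:
  assumes "t I 0 = i" "t InU i = of_bool (i \<in> U)" "t A i = a i"
  shows "results csa_min_body t =
    {if i \<in> U \<and> (t Found 0 = 0 \<or> a i < t Min_A 0)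
     then t(Min_A := (t Min_A)(0 := a i), Found := (t Found)(0 := 1), I := (t I)(0 := Suc i))
     else t(I := (t I)(0 := Suc i))}"
  using assms by (auto simp: csa_min_body_def)

lemma csa_min_ok:
  assumes U: "U \<subseteq> {..<k}" "U \<noteq> {}"
    and s: "s NumDemands 0 = k" "\<And>i. i < k \<Longrightarrow> s InU i = of_bool (i \<in> U)"
      "\<And>i. i < k \<Longrightarrow> s A i = a i"
  shows "ok (\<lambda>t. agree_off {Found, I, Min_A} s t \<and> t Min_A 0 = Min (a ` U))
           (k * 8 + 5) csa_min s"
proof -
  \<comment> \<open>\<open>Min_A\<close> is constrained only once a remaining demand has been seen:
    before that it may be left over from an earlier iteration, and \<open>Min {}\<close> is
    unspecified.\<close>
  define P where "P i t \<longleftrightarrow> agree_off {Found, I, Min_A} s t \<and> t I 0 = i \<and>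
    t Found 0 = of_bool (U \<inter> {..<i} \<noteq> {}) \<and>
    (U \<inter> {..<i} \<noteq> {} \<longrightarrow> t Min_A 0 = Min (a ` (U \<inter> {..<i})))" for i t
  have init: "ok (P 0) 3 (Found ::= Lit 0;; I ::= Lit 0) s"
    by (rule ok_mono[OF ok_loopfree[where Q = "P 0"]]) (auto simp: P_def)
  have body: "ok (P (Suc i)) 6 csa_min_body t" if t: "P i t" "i < k" for i t
  proof -
    have ag: "agree_off {Found, I, Min_A} s t" and [simp]: "t I 0 = i"
      "t Found 0 = of_bool (U \<inter> {..<i} \<noteq> {})"
      and Min: "U \<inter> {..<i} \<noteq> {} \<Longrightarrow> t Min_A 0 = Min (a ` (U \<inter> {..<i}))"
      using t(1) by (simp_all add: P_def)
    have "t InU = s InU" "t A = s A" using agree_offD[OF ag] by simp_all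
    then have "t InU i = of_bool (i \<in> U)" "t A i = a i" using s t(2) by simp_all
    note res = csa_min_body_results[of t i U a, OF \<open>t I 0 = i\<close> this]
    have "P (Suc i) u" if u: "u \<in> results csa_min_body t" for u
    proof (cases "i \<in> U")
      case False
      then show ?thesis using u ag Min by (auto simp: res P_def Int_lessThan_Suc)
    next
      case True
      show ?thesis
      proof (cases "U \<inter> {..<i} = {}")
        case empty: True
        then show ?thesis using u ag True by (simp add: res P_def Int_lessThan_Suc)
      next
        case False
        then have "Min (a ` insert i (U \<inter> {..<i})) = min (a i) (t Min_A 0)"
          unfolding image_insert by (subst Min_insert) (auto simp: Min)
        then show ?thesis using u ag True False
          by (cases "a i < t Min_A 0") (simp_all add: res P_def Int_lessThan_Suc min_def)
      qed
    qed
    then show ?thesis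
      by (intro ok_mono[OF ok_loopfree[where Q = "P (Suc i)"]]) (auto simp: csa_min_body_def)
  qed
  have cond: "bval (Lt (Var I) (Var NumDemands)) t \<longleftrightarrow> i < k" if "P i t" for i t
    using that s agree_offD[of _ s t NumDemands] by (auto simp: P_def)
  have fin: "U \<inter> {..<k} = U" using U by auto
  have "ok (P k) (Suc (3 + (k * (6 + 2) + 1))) csa_min s"
    unfolding csa_min_def csa_min_body_def[symmetric]
    by (rule ok_Seq[OF init ok_for[where P = P]]) (use cond body in auto)
  then show ?thesis
    by (rule ok_mono) (use U in \<open>auto simp: P_def fin\<close>)
qed

text \<open>The numbers from \<open>m\<close> to \<open>\<sigma> - 1\<close> all lie in
  \<open>X\<close>, so there are at most \<open>card X\<close> of them. This keeps the search for a
  slot short however large the release dates are.\<close>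

lemma Least_not_in:
  fixes X :: "nat set"
  assumes "finite X" and \<sigma>: "\<sigma> = (LEAST v. m \<le> v \<and> v \<notin> X)"
  shows "m \<le> \<sigma>" "\<sigma> \<notin> X" "\<And>v. m \<le> v \<Longrightarrow> v < \<sigma> \<Longrightarrow> v \<in> X" "\<sigma> - m \<le> card X"
proof -
  have "infinite ({m..} - X)" using assms(1) by (simp add: infinite_Ici)
  then have "\<exists>v. m \<le> v \<and> v \<notin> X" by (metis Diff_iff atLeast_iff finite.emptyI all_not_in_conv)
  from LeastI_ex[OF this] show "m \<le> \<sigma>" "\<sigma> \<notin> X" by (auto simp: \<sigma>)
  show less: "v \<in> X" if "m \<le> v" "v < \<sigma>" for v
    using not_less_Least[of v "\<lambda>v. m \<le> v \<and> v \<notin> X"] that by (auto simp: \<sigma>)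
  have "card {m..<\<sigma>} \<le> card X" by (rule card_mono) (use assms(1) less in auto)
  then show "\<sigma> - m \<le> card X" by simp
qed

section \<open>The search for the first free slot\<close>

definition csa_slot_loop :: "reg com" where
  "csa_slot_loop =
     WHILE Lt (Var J) (Var NumOcc) DO (
       (IF Eq (Occ .[Var J]) (Var Slot) THEN Found ::= Lit 1 ELSE Skip);;
       J ::= Add (Var J) (Lit 1))"

definition csa_slot_incr :: "reg com" where
  "csa_slot_incr = IF Eq (Var Found) (Lit 1) THEN Slot ::= Add (Var Slot) (Lit 1) ELSE Skip"

lemma csa_slot_alt:
  "csa_slot = Slot ::= Var Min_A;; Found ::= Lit 1;;
     WHILE Eq (Var Found) (Lit 1) DO (
       Found ::= Lit 0;; J ::= Lit 0;; csa_slot_loop;; csa_slot_incr)"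
  by (simp add: csa_slot_def csa_slot_loop_def csa_slot_incr_def)

lemma csa_slot_ok:
  assumes s: "s Min_A 0 = m" "s NumOcc 0 = n" "s Occ ` {..<n} = X"
  shows "ok (\<lambda>t. agree_off {Slot, Found, J} s t \<and> t Slot 0 = (LEAST v. m \<le> v \<and> v \<notin> X))
           ((n + 1) * (n * 6 + 10) + 5) csa_slot s"
proof -
  define \<sigma> where "\<sigma> = (LEAST v. m \<le> v \<and> v \<notin> X)"
  have "finite X" using s by auto
  note \<sigma> = Least_not_in[OF this \<sigma>_def]
  have "card X \<le> n" using s(3) card_image_le[of "{..<n}" "s Occ"] by auto
  with \<sigma> have D: "\<sigma> - m \<le> n" by linarith
  \<comment> \<open>Pass \<open>i < \<sigma> - m\<close> advances the slot; pass
    \<open>i = \<sigma> - m\<close> finds it free, leaves it in place and clears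
    \<open>Found\<close>. Hence the \<open>min\<close>, and \<open>\<sigma> - m + 1\<close> passes
    in all.\<close>
  define P where "P i t \<longleftrightarrow> agree_off {Slot, Found, J} s t \<and> t Slot 0 = min (m + i) \<sigma> \<and>
    t Found 0 = of_bool (i \<le> \<sigma> - m)" for i t
  have init: "ok (P 0) 3 (Slot ::= Var Min_A;; Found ::= Lit 1) s"
    by (rule ok_mono[OF ok_loopfree[where Q = "P 0"]])
      (use s \<sigma>(1) in \<open>auto simp: P_def\<close>)
  have body: "ok (P (Suc i)) (n * 6 + 8) (
       Found ::= Lit 0;; J ::= Lit 0;; csa_slot_loop;; csa_slot_incr) t"
    if t: "P i t" "i < \<sigma> - m + 1" for i t
  proof -
    define R where "R j u \<longleftrightarrow> agree_off {Slot, Found, J} s u \<and> u Slot 0 = t Slot 0 \<and> u J 0 = j \<and>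
      u Found 0 = of_bool (t Slot 0 \<in> s Occ ` {..<j})" for j u
    have ag: "agree_off {Slot, Found, J} s t" and slot: "t Slot 0 = m + i" "m + i \<le> \<sigma>"
      using t \<sigma>(1) by (auto simp: P_def)
    have "ok (R 0) 3 (Found ::= Lit 0;; J ::= Lit 0) t"
      by (rule ok_mono[OF ok_loopfree[where Q = "R 0"]]) (use ag in \<open>auto simp: R_def\<close>)
    moreover have "ok (R (Suc j)) 4 (
         (IF Eq (Occ .[Var J]) (Var Slot) THEN Found ::= Lit 1 ELSE Skip);;
         J ::= Add (Var J) (Lit 1)) u" if u: "R j u" for j u
    proof -
      have [simp]: "u Occ = s Occ" using u agree_offD[of _ s u Occ] by (auto simp: R_def)
      show ?thesis
        by (rule ok_mono[OF ok_loopfree[where Q = "R (Suc j)"]])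
          (use u in \<open>auto simp: R_def lessThan_Suc\<close>)
    qed
    moreover have "bval (Lt (Var J) (Var NumOcc)) u \<longleftrightarrow> j < n" if "R j u" for j u
      using that s agree_offD[of _ s u NumOcc] by (auto simp: R_def)
    ultimately have "ok (R n) (Suc (3 + (n * (4 + 2) + 1)))
       (Found ::= Lit 0;; J ::= Lit 0;; csa_slot_loop) t"
      unfolding csa_slot_loop_def by (intro ok_Seq[of "R 0"] ok_for[where P = R]) auto
    moreover have "\<forall>w\<in>results csa_slot_incr u. P (Suc i) w" if u: "R n u" for u
    proof -
      \<comment> \<open>The probed slot is at most \<sigma>. Below \<sigma> it is occupied by
        minimality, and \<sigma> itself is free.\<close>
      have "t Slot 0 \<in> s Occ ` {..<n} \<longleftrightarrow> m + i < \<sigma>"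
        using \<sigma>(2,3) slot s(3) by (metis le_add1 le_neq_implies_less less_irrefl)
      then have "u Found 0 = of_bool (m + i < \<sigma>)" using u by (auto simp: R_def)
      moreover have "u Slot 0 = m + i" "agree_off {Slot, Found, J} s u"
        using u slot by (auto simp: R_def)
      ultimately show ?thesis using slot(2) \<sigma>(1)
        by (auto simp: P_def csa_slot_incr_def)
    qed
    ultimately have "ok (\<lambda>u. \<forall>w\<in>results csa_slot_incr u. P (Suc i) w)
        (Suc (3 + (n * (4 + 2) + 1))) (Found ::= Lit 0;; J ::= Lit 0;; csa_slot_loop) t"
      by (rule ok_mono[OF _ order.refl])
    from ok_Seq_loopfree[OF _ this] show ?thesis
      by (rule ok_mono) (simp_all add: csa_slot_incr_def)
  qed
  have cond: "bval (Eq (Var Found) (Lit 1)) t \<longleftrightarrow> i < \<sigma> - m + 1" if "P i t" for i t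
    using that by (auto simp: P_def)
  have "ok (P (\<sigma> - m + 1)) (Suc (3 + ((\<sigma> - m + 1) * (n * 6 + 8 + 2) + 1))) csa_slot s"
    unfolding csa_slot_alt
    by (rule ok_Seq[OF init ok_for[where P = P]]) (use cond body in auto)
  moreover have "Suc (3 + ((\<sigma> - m + 1) * (n * 6 + 8 + 2) + 1)) \<le> (n + 1) * (n * 6 + 10) + 5"
  proof -
    have "n * 6 + 8 + 2 = n * 6 + 10" by simp
    moreover have "(\<sigma> - m + 1) * (n * 6 + 10) \<le> (n + 1) * (n * 6 + 10)"
      using D by (intro mult_le_mono1) simp
    ultimately show ?thesis by presburger
  qed
  ultimately show ?thesis
    by (rule ok_mono) (use \<sigma>(1) in \<open>auto simp: P_def \<sigma>_def[symmetric]\<close>)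
qed

section \<open>The choice of a released demand with the largest tail\<close>

definition csa_best_body :: "reg com" where
  "csa_best_body =
       (IF Conj (Eq (InU .[Var I]) (Lit 1)) (Neg (Lt (Var Slot) (A .[Var I]))) THEN
         IF Disj (Eq (Var Found) (Lit 0)) (Lt (B .[Var Best]) (B .[Var I]))
         THEN (Best ::= Var I;; Found ::= Lit 1)
         ELSE IF Eq (B .[Var Best]) (B .[Var I])
         THEN Choice (Best ::= Var I) Skip
         ELSE Skip
        ELSE Skip);;
       I ::= Add (Var I) (Lit 1)"

lemma csa_best_alt:
  "csa_best = Found ::= Lit 0;; I ::= Lit 0;;
     WHILE Lt (Var I) (Var NumDemands) DO csa_best_body"
  by (simp add: csa_best_def csa_best_body_def)

text \<open>While \<open>Found\<close> is 0, \<open>Best\<close> may be stale from an earlier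
  iteration, so \<open>t B\<close> is tied to \<open>b\<close> at \<open>Best\<close> only when
  \<open>Found\<close> is set. Otherwise a candidate enters the first branch whatever
  \<open>Best\<close> holds.\<close>

lemma csa_best_body_results:
  assumes "t I 0 = i" "t InU i = of_bool (i \<in> U)" "t A i = a i" "t B i = b i"
    and E: "E = {j \<in> U. a j \<le> t Slot 0}"
    and Best: "t Found 0 \<noteq> 0 \<Longrightarrow> t B (t Best 0) = b (t Best 0)"
  shows "results csa_best_body t =
    (if i \<in> E \<and> (t Found 0 = 0 \<or> b (t Best 0) < b i)
     then {t(Best := (t Best)(0 := i), Found := (t Found)(0 := 1), I := (t I)(0 := Suc i))}
     else if i \<in> E \<and> b (t Best 0) = b i
     then {t(Best := (t Best)(0 := i), I := (t I)(0 := Suc i)), t(I := (t I)(0 := Suc i))}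
     else {t(I := (t I)(0 := Suc i))})"
  using assms by (cases "i \<in> E"; cases "t Found 0 = 0") (auto simp: csa_best_body_def)

text \<open>The two claims need different invariants. For soundness, \<open>Best\<close> is a
  maximiser among the candidates scanned so far. To reach a prescribed maximiser \<open>i0\<close>,
  one run is steered: \<open>i0\<close> is taken when the scan meets it, and later ties are
  declined.\<close>

lemma csa_best_ok_can:
  assumes U: "U \<subseteq> {..<k}" and E: "E = {j \<in> U. a j \<le> s Slot 0}" "E \<noteq> {}"
    and s: "s NumDemands 0 = k" "\<And>i. i < k \<Longrightarrow> s InU i = of_bool (i \<in> U)"
      "\<And>i. i < k \<Longrightarrow> s A i = a i" "\<And>i. i < k \<Longrightarrow> s B i = b i"
  shows "ok (\<lambda>t. agree_off {Found, I, Best} s t \<and> t Best 0 \<in> E \<and> (\<forall>j\<in>E. b j \<le> b (t Best 0)))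
           (k * 12 + 5) csa_best s" (is ?ok)
    and "i0 \<in> E \<Longrightarrow> \<forall>j\<in>E. b j \<le> b i0 \<Longrightarrow>
           can (\<lambda>t. agree_off {Found, I, Best} s t \<and> t Best 0 = i0) csa_best s" (is "PROP ?can")
proof -
  have results: "results csa_best_body t =
    (if i \<in> E \<and> (t Found 0 = 0 \<or> b (t Best 0) < b i)
     then {t(Best := (t Best)(0 := i), Found := (t Found)(0 := 1), I := (t I)(0 := Suc i))}
     else if i \<in> E \<and> b (t Best 0) = b i
     then {t(Best := (t Best)(0 := i), I := (t I)(0 := Suc i)), t(I := (t I)(0 := Suc i))}
     else {t(I := (t I)(0 := Suc i))})"
    if ag: "agree_off {Found, I, Best} s t" and "t I 0 = i" "i < k"
      and Best: "t Found 0 \<noteq> 0 \<longrightarrow> t Best 0 \<in> E" for t i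
  proof -
    have "t InU = s InU" "t A = s A" "t B = s B" "t Slot = s Slot"
      using agree_offD[OF ag] by simp_all
    moreover have "E \<subseteq> {..<k}" using E U by auto
    ultimately show ?thesis
      using that s by (intro csa_best_body_results[where U = U and a = a]) (auto simp: E(1))
  qed
  have fin: "E \<inter> {..<k} = E" using E U by auto
  have cond: "bval (Lt (Var I) (Var NumDemands)) t \<longleftrightarrow> i < k"
    if "agree_off {Found, I, Best} s t" "t I 0 = i" for t i
    using that s agree_offD[of _ s t NumDemands] by simp

  define P where "P i t \<longleftrightarrow> agree_off {Found, I, Best} s t \<and> t I 0 = i \<and>
    t Found 0 = of_bool (E \<inter> {..<i} \<noteq> {}) \<and>
    (E \<inter> {..<i} \<noteq> {} \<longrightarrow> t Best 0 \<in> E \<and> (\<forall>j\<in>E \<inter> {..<i}. b j \<le> b (t Best 0)))" for i t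
  have "ok (P 0) 3 (Found ::= Lit 0;; I ::= Lit 0) s"
    by (rule ok_mono[OF ok_loopfree[where Q = "P 0"]]) (auto simp: P_def)
  moreover have "ok (P (Suc i)) 10 csa_best_body t" if t: "P i t" "i < k" for i t
  proof -
    have ag: "agree_off {Found, I, Best} s t" "t I 0 = i" using t by (simp_all add: P_def)
    have "t Found 0 \<noteq> 0 \<longrightarrow> t Best 0 \<in> E" using t(1) by (auto simp: P_def)
    note res = results[OF ag t(2) this]
    have "P (Suc i) u" if u: "u \<in> results csa_best_body t" for u
    proof (cases "i \<in> E")
      case False
      then show ?thesis using t(1) u by (simp add: res P_def Int_lessThan_Suc)
    next
      case True
      show ?thesis
      proof (cases "E \<inter> {..<i} = {}")
        case empty: True
        then have "t Found 0 = 0" using t(1) by (simp add: P_def)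
        then show ?thesis using True empty ag u by (simp add: res P_def Int_lessThan_Suc)
      next
        case False
        then have *: "t Found 0 = 1" "t Best 0 \<in> E" "\<forall>j\<in>E \<inter> {..<i}. b j \<le> b (t Best 0)"
          using t(1) by (simp_all add: P_def)
        have "\<forall>j\<in>E \<inter> {..<i}. b j \<le> b i" if "b (t Best 0) < b i"
        proof
          fix j assume "j \<in> E \<inter> {..<i}"
          then have "b j \<le> b (t Best 0)" using *(3) by blast
          with that show "b j \<le> b i" by simp
        qed
        then show ?thesis using u ag True False *
          by (cases "b (t Best 0)" "b i" rule: linorder_cases)
            (auto simp add: res P_def Int_lessThan_Suc)
      qed
    qed
    then show ?thesis
      by (intro ok_mono[OF ok_loopfree[where Q = "P (Suc i)"]]) (auto simp: csa_best_body_def)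
  qed
  moreover have "bval (Lt (Var I) (Var NumDemands)) t \<longleftrightarrow> i < k" if "P i t" for i t
    using that cond by (simp add: P_def)
  ultimately have "ok (P k) (Suc (3 + (k * (10 + 2) + 1))) csa_best s"
    unfolding csa_best_alt by (intro ok_Seq[of "P 0"] ok_for[where P = P]) auto
  then show ?ok
    by (rule ok_mono) (use E(2) in \<open>auto simp: P_def fin\<close>)

  assume i0: "i0 \<in> E" "\<forall>j\<in>E. b j \<le> b i0"
  \<comment> \<open>What \<open>Best\<close> holds before the scan reaches \<open>i0\<close> is left
    open: as an element of \<open>E\<close> it has tail at most \<open>b i0\<close>, so
    \<open>i0\<close> replaces it either strictly or by the left branch of
    \<open>Choice\<close>.\<close>
  define Q where "Q i t \<longleftrightarrow> agree_off {Found, I, Best} s t \<and> t I 0 = i \<and>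
    (t Found 0 \<noteq> 0 \<longrightarrow> t Best 0 \<in> E) \<and> (i0 < i \<longrightarrow> t Found 0 \<noteq> 0 \<and> t Best 0 = i0)" for i t
  have Q_init: "can (Q 0) (Found ::= Lit 0;; I ::= Lit 0) s"
    by (rule can_loopfree) (auto simp: Q_def)
  have Q_body: "can (Q (Suc i)) csa_best_body t" if t: "Q i t" "i < k" for i t
  proof -
    have ag: "agree_off {Found, I, Best} s t" "t I 0 = i"
      and Best: "t Found 0 \<noteq> 0 \<longrightarrow> t Best 0 \<in> E" using t by (auto simp: Q_def)
    note res = results[OF ag t(2) Best]
    have "\<exists>u\<in>results csa_best_body t. Q (Suc i) u"
    proof -
      consider "i < i0" | "i = i0" | "i0 < i" by linarith
      then show ?thesis
      proof cases
        case 1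
        then show ?thesis using ag Best by (auto simp: res Q_def)
      next
        case 2
        then have "t Found 0 = 0 \<or> b (t Best 0) \<le> b i" using i0 Best by auto
        then show ?thesis using ag i0 2 by (auto simp: res Q_def le_less)
      next
        case 3
        then have "t Found 0 \<noteq> 0" "t Best 0 = i0" using t by (auto simp: Q_def)
        \<comment> \<open>No later tail is larger, so \<open>Best\<close> could change only on a
          tie, and there the \<open>Skip\<close> branch keeps it.\<close>
        moreover have "i \<in> E \<Longrightarrow> \<not> b i0 < b i" using i0 by (simp add: leD)
        ultimately show ?thesis using ag i0(1) 3 by (auto simp: res Q_def)
      qed
    qed
    then obtain u where u: "u \<in> results csa_best_body t" "Q (Suc i) u" by blast
    have "loopfree csa_best_body" by (simp add: csa_best_body_def)
    then show ?thesis by (rule can_loopfree[OF _ u(1)]) (rule u(2))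
  qed
  have Q_cond: "bval (Lt (Var I) (Var NumDemands)) t \<longleftrightarrow> i < k" if "Q i t" for i t
    using that cond by (simp add: Q_def)
  have "can (Q k) (WHILE Lt (Var I) (Var NumDemands) DO csa_best_body) t" if "Q 0 t" for t
    by (rule can_for[where P = Q, OF that]) (use Q_cond Q_body in auto)
  then have "can (Q k) csa_best s"
    unfolding csa_best_alt by (rule can_Seq[OF Q_init])
  moreover have "i0 < k" using i0(1) fin by auto
  ultimately show "can (\<lambda>t. agree_off {Found, I, Best} s t \<and> t Best 0 = i0) csa_best s"
    by - (erule can_mono, simp add: Q_def)
qed

section \<open>One iteration of the main loop\<close>

definition csa_select :: "reg com" where
  "csa_select = csa_min;; csa_slot;; csa_best"

definition csa_body :: "reg com" where
  "csa_body =
     csa_select;;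
     Delay .[Var Best] ::= Sub (Var Slot) (A .[Var Best]);;
     InU .[Var Best] ::= Lit 0;;
     CardU ::= Sub (Var CardU) (Lit 1);;
     Occ .[Var NumOcc] ::= Var Slot;;
     NumOcc ::= Add (Var NumOcc) (Lit 1)"

lemma csa_prog_alt: "csa_prog = csa_init;; WHILE Lt (Lit 0) (Var CardU) DO csa_body"
  by (simp add: csa_prog_def csa_body_def csa_select_def)

text \<open>The five closing assignments as one simultaneous update. This is faithful because none
  of them reads a cell overwritten by an earlier one; in particular \<open>NumOcc\<close> is
  incremented only after it has indexed \<open>Occ\<close>.\<close>

definition csa_update :: "reg mem \<Rightarrow> reg mem" where
  "csa_update u = u(
     Delay := (u Delay)(u Best 0 := u Slot 0 - u A (u Best 0)),
     InU := (u InU)(u Best 0 := 0),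
     CardU := (u CardU)(0 := u CardU 0 - 1),
     Occ := (u Occ)(u NumOcc 0 := u Slot 0),
     NumOcc := (u NumOcc)(0 := Suc (u NumOcc 0)))"

lemma ok_Seq_Assign:
  assumes "ok (\<lambda>t. Q (t(v := (t v)(aval e t := aval f t)))) n c s"
  shows "ok Q (n + 2) (c;; v .[e] ::= f) s"
  using ok_Seq_loopfree[of "v .[e] ::= f" Q n c s] assms by (simp del: ok.simps)

lemma csa_body_ok:
  assumes "ok P n csa_select s" "\<And>u. P u \<Longrightarrow> Q (csa_update u)"
  shows "ok Q (n + 10) csa_body s"
proof -
  have "ok (\<lambda>u. Q (csa_update u)) n csa_select s"
    using assms(1) order.refl assms(2) by (rule ok_mono)
  then have "ok Q (n + 2 + 2 + 2 + 2 + 2) csa_body s"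
    unfolding csa_body_def by (intro ok_Seq_Assign) (simp add: csa_update_def)
  then show ?thesis by (rule ok_mono) simp_all
qed

lemma csa_body_can:
  assumes "can P csa_select s" "\<And>u. P u \<Longrightarrow> Q (csa_update u)"
  shows "can Q csa_body s"
proof -
  have "can (\<lambda>u. Q (csa_update u)) csa_select s"
    using assms by (rule can_mono)
  then show ?thesis
    unfolding csa_body_def
    by (intro can_Seq_loopfree) (simp_all add: csa_update_def)
qed

text \<open>\<open>s0\<close> is the state after initialisation, whose lengths and walks must
  survive. The equation between \<open>NumOcc\<close>, \<open>card U\<close> and \<open>k\<close> is
  what later bounds the slot search in terms of \<open>k\<close>.\<close>

fun csa_inv :: "reg mem \<Rightarrow> nat \<Rightarrow> nat set \<times> nat set \<times> (nat \<Rightarrow> nat) \<Rightarrow> reg mem \<Rightarrow> bool" where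
  "csa_inv s0 k (U, X, d) t \<longleftrightarrow>
     agree_off {Delay, InU, CardU, Occ, NumOcc, Min_A, Slot, Best, Found, I, J} s0 t \<and>
     U \<subseteq> {..<k} \<and> (\<forall>i<k. t InU i = of_bool (i \<in> U)) \<and> t CardU 0 = card U \<and>
     (\<forall>i<k. t Delay i = d i) \<and>
     t NumOcc 0 + card U = k \<and> t Occ ` {..<t NumOcc 0} = X"

lemma csa_select_ok_can:
  assumes inv: "csa_inv s0 k (U, X, d) s" and "U \<noteq> {}"
    and s0: "s0 NumDemands 0 = k" "\<And>i. i < k \<Longrightarrow> s0 A i = a i" "\<And>i. i < k \<Longrightarrow> s0 B i = b i"
    and m: "m = Min (a ` U)" and \<sigma>: "\<sigma> = (LEAST v. m \<le> v \<and> v \<notin> X)"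
  shows "ok (\<lambda>u. agree_off {Min_A, Slot, Best, Found, I, J} s u \<and> u Slot 0 = \<sigma> \<and>
             u Best 0 \<in> U \<and> a (u Best 0) \<le> \<sigma> \<and> (\<forall>j\<in>U. a j \<le> \<sigma> \<longrightarrow> b j \<le> b (u Best 0)))
           (Suc (Suc ((k * 8 + 5) + ((k + 1) * (k * 6 + 10) + 5)) + (k * 12 + 5))) csa_select s" (is ?ok)
    and "i \<in> U \<Longrightarrow> a i \<le> \<sigma> \<Longrightarrow> \<forall>j\<in>U. a j \<le> \<sigma> \<longrightarrow> b j \<le> b i \<Longrightarrow>
           can (\<lambda>u. agree_off {Min_A, Slot, Best, Found, I, J} s u \<and> u Slot 0 = \<sigma> \<and> u Best 0 = i)
             csa_select s" (is "PROP ?can")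
proof -
  have U: "U \<subseteq> {..<k}" and InU: "\<And>i. i < k \<Longrightarrow> s InU i = of_bool (i \<in> U)"
    and n: "s NumOcc 0 \<le> k" and X: "s Occ ` {..<s NumOcc 0} = X"
    and ag: "agree_off {Delay, InU, CardU, Occ, NumOcc, Min_A, Slot, Best, Found, I, J} s0 s"
    using inv by auto
  have s: "s NumDemands 0 = k" "\<And>i. i < k \<Longrightarrow> s A i = a i" "\<And>i. i < k \<Longrightarrow> s B i = b i"
    using agree_offD[OF ag, of NumDemands] agree_offD[OF ag, of A] agree_offD[OF ag, of B] s0 by simp_all
  define P where "P u \<longleftrightarrow> agree_off {Min_A, Slot, Found, I, J} s u \<and> u Slot 0 = \<sigma>" for u
  have slot: "ok P ((k + 1) * (k * 6 + 10) + 5) csa_slot u"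
    if u: "agree_off {Found, I, Min_A} s u \<and> u Min_A 0 = Min (a ` U)" for u
  proof -
    have ag': "agree_off {Found, I, Min_A} s u" using u ..
    have "u Occ = s Occ" "u NumOcc = s NumOcc" using agree_offD[OF ag'] by simp_all
    then have "ok (\<lambda>v. agree_off {Slot, Found, J} u v \<and> v Slot 0 = \<sigma>)
      ((s NumOcc 0 + 1) * (s NumOcc 0 * 6 + 10) + 5) csa_slot u"
      unfolding \<sigma> using u X by (intro csa_slot_ok) (simp_all add: m)
    then show ?thesis
    proof (rule ok_mono)
      show "(s NumOcc 0 + 1) * (s NumOcc 0 * 6 + 10) + 5 \<le> (k + 1) * (k * 6 + 10) + 5"
        using n by (intro add_le_mono mult_le_mono) auto
    qed (use ag' in \<open>auto simp: P_def agree_off_def\<close>)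
  qed
  have P: "ok P (Suc ((k * 8 + 5) + ((k + 1) * (k * 6 + 10) + 5))) (csa_min;; csa_slot) s"
    by (rule ok_Seq[OF csa_min_ok[where a = a and U = U]]) (use U \<open>U \<noteq> {}\<close> s InU slot in auto)
  define E where "E = {j \<in> U. a j \<le> \<sigma>}"
  have "finite X" using X by auto
  have "finite U" using U finite_subset by blast
  then have "m \<in> a ` U" unfolding m using \<open>U \<noteq> {}\<close> by (intro Min_in) auto
  then have E: "E \<noteq> {}" using Least_not_in(1)[OF \<open>finite X\<close> \<sigma>] by (auto simp: E_def)
  have best: "ok (\<lambda>t. agree_off {Found, I, Best} u t \<and> t Best 0 \<in> E \<and> (\<forall>j\<in>E. b j \<le> b (t Best 0)))
           (k * 12 + 5) csa_best u"
    "i0 \<in> E \<Longrightarrow> \<forall>j\<in>E. b j \<le> b i0 \<Longrightarrow>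
           can (\<lambda>t. agree_off {Found, I, Best} u t \<and> t Best 0 = i0) csa_best u" if u: "P u" for u i0
  proof -
    have ag': "agree_off {Min_A, Slot, Found, I, J} s u" "u Slot 0 = \<sigma>" using u by (simp_all add: P_def)
    have eq: "u NumDemands = s NumDemands" "u InU = s InU" "u A = s A" "u B = s B"
      using agree_offD[OF ag'(1)] by simp_all
    show "ok (\<lambda>t. agree_off {Found, I, Best} u t \<and> t Best 0 \<in> E \<and> (\<forall>j\<in>E. b j \<le> b (t Best 0)))
           (k * 12 + 5) csa_best u"
      by (rule csa_best_ok_can(1)[where U = U and a = a])
        (use U E s InU ag' eq in \<open>auto simp: E_def\<close>)
    show "can (\<lambda>t. agree_off {Found, I, Best} u t \<and> t Best 0 = i0) csa_best u"
      if "i0 \<in> E" "\<forall>j\<in>E. b j \<le> b i0"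
      by (rule csa_best_ok_can(2)[where U = U and a = a and b = b and E = E])
        (use U E s InU ag' eq that in \<open>auto simp: E_def\<close>)
  qed
  have trans: "agree_off {Min_A, Slot, Best, Found, I, J} s t \<and> t Slot 0 = \<sigma>"
    if "P u" "agree_off {Found, I, Best} u t" for u t
    using that agree_offD[of _ u t Slot] by (auto simp: P_def agree_off_def)
  show ?ok
    unfolding csa_select_def
    by (rule ok_Seq[OF P ok_mono[OF best(1) order.refl]]) (use trans in \<open>auto simp: E_def\<close>)
  assume "i \<in> U" "a i \<le> \<sigma>" "\<forall>j\<in>U. a j \<le> \<sigma> \<longrightarrow> b j \<le> b i"
  then have "i \<in> E" "\<forall>j\<in>E. b j \<le> b i" by (auto simp: E_def)
  then show "can (\<lambda>u. agree_off {Min_A, Slot, Best, Found, I, J} s u \<and> u Slot 0 = \<sigma> \<and> u Best 0 = i)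
             csa_select s"
    unfolding csa_select_def
    by (intro can_Seq[OF can_if_ok[OF P]] can_mono[OF best(2)]) (use trans in auto)
qed

lemma csa_inv_update:
  assumes inv: "csa_inv s0 k (U, X, d) s"
    and u: "agree_off {Min_A, Slot, Best, Found, I, J} s u" "u Slot 0 = \<sigma>" "u Best 0 = i" "i \<in> U"
    and s0: "\<And>i. i < k \<Longrightarrow> s0 A i = a i"
  shows "csa_inv s0 k (U - {i}, insert \<sigma> X, d(i := \<sigma> - a i)) (csa_update u)"
proof -
  have eq: "u InU = s InU" "u CardU = s CardU" "u Delay = s Delay" "u NumOcc = s NumOcc"
    "u Occ = s Occ" "u A = s A"
    using agree_offD[OF u(1)] by simp_all
  have ag: "agree_off {Delay, InU, CardU, Occ, NumOcc, Min_A, Slot, Best, Found, I, J} s0 s"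
    using inv by simp
  have "i < k" "finite U" using inv u(4) finite_subset[of U "{..<k}"] by auto
  then have "card (U - {i}) = card U - 1" "0 < card U" using u(4) by (auto simp: card_gt_0_iff)
  moreover have "s A i = a i" using ag s0 \<open>i < k\<close> agree_offD[OF ag, of A] by simp
  moreover have "agree_off {Delay, InU, CardU, Occ, NumOcc, Min_A, Slot, Best, Found, I, J} s0 (csa_update u)"
    using inv u(1) by (auto simp: csa_update_def agree_off_def)
  moreover have "(s Occ)(s NumOcc 0 := \<sigma>) ` {..<Suc (s NumOcc 0)} = insert \<sigma> (s Occ ` {..<s NumOcc 0})"
    by (auto simp: lessThan_Suc image_def)
  ultimately show ?thesis
    using inv u eq by (auto simp: csa_update_def)
qed

section \<open>Initialisation: walks and arc lengths\<close>

definition csa_init_walk :: "reg com" where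
  "csa_init_walk =
     W0 .[Var I] ::= Src .[Var I];;
     (IF Disj (Eq (Src .[Var I]) (Var Centre)) (Eq (Dst .[Var I]) (Var Centre)) THEN (
       W1 .[Var I] ::= Dst .[Var I];;
       WLen .[Var I] ::= Lit 2)
     ELSE (
       W1 .[Var I] ::= Var Centre;;
       W2 .[Var I] ::= Dst .[Var I];;
       WLen .[Var I] ::= Lit 3));;
     J ::= Lit 0"

definition csa_init_lens_body :: "reg com" where
  "csa_init_lens_body =
     (IF Conj (Eq (Tail .[Var J]) (Src .[Var I])) (Eq (Head .[Var J]) (Var Centre))
      THEN A .[Var I] ::= Len .[Var J] ELSE Skip);;
     (IF Conj (Eq (Tail .[Var J]) (Var Centre)) (Eq (Head .[Var J]) (Dst .[Var I]))
      THEN B .[Var I] ::= Len .[Var J] ELSE Skip);;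
     J ::= Add (Var J) (Lit 1)"

lemma csa_init_alt:
  "csa_init =
     I ::= Lit 0;;
     WHILE Lt (Var I) (Var NumDemands) DO (
       csa_init_walk;;
       WHILE Lt (Var J) (Var NumArcs) DO csa_init_lens_body;;
       InU .[Var I] ::= Lit 1;;
       I ::= Add (Var I) (Lit 1));;
     CardU ::= Var NumDemands;;
     NumOcc ::= Lit 0"
  by (simp add: csa_init_def csa_init_walk_def csa_init_lens_body_def)

text \<open>\<open>W2\<close> is left open for a walk of two vertices, since only the first
  \<open>WLen\<close> entries are read back.\<close>

definition walk_stored :: "nat \<Rightarrow> nat \<Rightarrow> nat \<Rightarrow> nat \<Rightarrow> reg mem \<Rightarrow> bool" where
  "walk_stored c src dst i t \<longleftrightarrow> t W0 i = src \<and>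
     (if src = c \<or> dst = c then t WLen i = 2 \<and> t W1 i = dst
      else t WLen i = 3 \<and> t W1 i = c \<and> t W2 i = dst)"

text \<open>The scan of the arcs overwrites, so every matching arc has to carry the length
  \<open>a i\<close>. If none matches, the initial 0 survives, which is correct because a nonzero
  \<open>a i\<close> is assumed to have a match. The same applies to \<open>b\<close>.\<close>

lemma csa_init_ok:
  assumes s: "s Centre 0 = c" "s NumArcs 0 = e" "s NumDemands 0 = k"
    and zero: "\<And>i. i < k \<Longrightarrow> s A i = 0 \<and> s B i = 0"
    and A: "\<And>i j. i < k \<Longrightarrow> j < e \<Longrightarrow> s Tail j = s Src i \<Longrightarrow> s Head j = c \<Longrightarrow> s Len j = a i"
      "\<And>i. i < k \<Longrightarrow> a i \<noteq> 0 \<Longrightarrow> \<exists>j<e. s Tail j = s Src i \<and> s Head j = c"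
    and B: "\<And>i j. i < k \<Longrightarrow> j < e \<Longrightarrow> s Tail j = c \<Longrightarrow> s Head j = s Dst i \<Longrightarrow> s Len j = b i"
      "\<And>i. i < k \<Longrightarrow> b i \<noteq> 0 \<Longrightarrow> \<exists>j<e. s Tail j = c \<and> s Head j = s Dst i"
  shows "ok (\<lambda>t. agree_off {W0, W1, W2, WLen, A, B, InU, I, J, CardU, NumOcc} s t \<and>
           t CardU 0 = k \<and> t NumOcc 0 = 0 \<and>
           (\<forall>i<k. t A i = a i \<and> t B i = b i \<and> t InU i = 1 \<and> walk_stored c (s Src i) (s Dst i) i t))
         (k * (e * 9 + 21) + 7) csa_init s"
proof -
  define X where "X = {W0, W1, W2, WLen, A, B, InU, I, J}"
  define D where "D i t \<longleftrightarrow>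
    t A i = a i \<and> t B i = b i \<and> t InU i = 1 \<and> walk_stored c (s Src i) (s Dst i) i t" for i t
  \<comment> \<open>\<open>D i\<close> reads cells at index \<open>i\<close> only, so demands
    already processed are not disturbed by writes at later indices.\<close>
  have D_cong: "D i u" if "D i t" "\<And>r. r \<in> {A, B, InU, W0, W1, W2, WLen} \<Longrightarrow> u r i = t r i" for i t u
    using that by (simp add: D_def walk_stored_def)
  define P where "P i t \<longleftrightarrow> agree_off X s t \<and> t I 0 = i \<and> (\<forall>i'<i. D i' t) \<and>
    (\<forall>i'<k. i \<le> i' \<longrightarrow> t A i' = 0 \<and> t B i' = 0)" for i t
  define MA where "MA i j \<longleftrightarrow> s Tail j = s Src i \<and> s Head j = c" for i j
  define MB where "MB i j \<longleftrightarrow> s Tail j = c \<and> s Head j = s Dst i" for i j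
  \<comment> \<open>Demand \<open>i\<close> in progress, after \<open>j\<close> arcs. The cells
    beyond \<open>i\<close> are kept at 0 because the scans for later demands rely on it.\<close>
  define R where "R i j t \<longleftrightarrow> agree_off X s t \<and> t I 0 = i \<and> t J 0 = j \<and> (\<forall>i'<i. D i' t) \<and>
    walk_stored c (s Src i) (s Dst i) i t \<and>
    t A i = (if \<exists>j'<j. MA i j' then a i else 0) \<and> t B i = (if \<exists>j'<j. MB i j' then b i else 0) \<and>
    (\<forall>i'<k. i < i' \<longrightarrow> t A i' = 0 \<and> t B i' = 0)" for i j t
  have static: "t Centre = s Centre" "t NumArcs = s NumArcs" "t NumDemands = s NumDemands"
    "t Src = s Src" "t Dst = s Dst" "t Tail = s Tail" "t Head = s Head" "t Len = s Len"
    if "agree_off X s t" for t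
    using agree_offD[OF that] by (simp_all add: X_def)
  have walk: "ok (R i 0) 13 csa_init_walk t" if t: "P i t" "i < k" for i t
  proof -
    have ag: "agree_off X s t" "t I 0 = i" using t by (simp_all add: P_def)
    have res: "results csa_init_walk t =
      {if s Src i = c \<or> s Dst i = c
       then t(W0 := (t W0)(i := s Src i), W1 := (t W1)(i := s Dst i), WLen := (t WLen)(i := 2),
              J := (t J)(0 := 0))
       else t(W0 := (t W0)(i := s Src i), W1 := (t W1)(i := c), W2 := (t W2)(i := s Dst i),
              WLen := (t WLen)(i := 3), J := (t J)(0 := 0))}"
      using ag(2) static[OF ag(1)] s by (auto simp: csa_init_walk_def fun_eq_iff)
    have "R i 0 u" if u: "u \<in> results csa_init_walk t" for u
    proof -
      have "D i' u" if "i' < i" for i'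
        by (rule D_cong[of i' t]) (use u that t(1) in \<open>auto simp: res P_def\<close>)
      moreover have "walk_stored c (s Src i) (s Dst i) i u"
        using u by (simp add: res walk_stored_def)
      moreover have "agree_off X s u" using u ag(1) by (simp add: res X_def)
      moreover have "u I 0 = i" "u J 0 = 0" "u A = t A" "u B = t B"
        using u ag(2) by (simp_all add: res)
      ultimately show ?thesis using t by (simp add: P_def R_def)
    qed
    then show ?thesis
      by (intro ok_mono[OF ok_loopfree[where Q = "R i 0"]]) (simp_all add: csa_init_walk_def)
  qed
  have lens: "ok (R i (Suc j)) 7 csa_init_lens_body t" if t: "R i j t" "i < k" "j < e" for i j t
  proof -
    have ag: "agree_off X s t" "t I 0 = i" "t J 0 = j" using t by (simp_all add: R_def)
    have res: "results csa_init_lens_body t =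
      {t(A := (t A)(i := if MA i j then a i else t A i),
         B := (t B)(i := if MB i j then b i else t B i), J := (t J)(0 := Suc j))}"
      using ag(2,3) static[OF ag(1)] s A(1)[of i j] B(1)[of i j] t(2,3)
      by (auto simp: csa_init_lens_body_def MA_def MB_def)
    have "R i (Suc j) u" if "u \<in> results csa_init_lens_body t" for u
    proof -
      have u: "u = t(A := (t A)(i := if MA i j then a i else t A i),
         B := (t B)(i := if MB i j then b i else t B i), J := (t J)(0 := Suc j))"
        using that by (simp add: res)
      have "D i' u" if "i' < i" for i'
        by (rule D_cong[of i' t]) (use that t(1) in \<open>auto simp: u R_def\<close>)
      moreover have "walk_stored c (s Src i) (s Dst i) i u"
        using t(1) by (simp add: u R_def walk_stored_def)
      moreover have "agree_off X s u" using ag(1) by (simp add: u X_def)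
      ultimately show ?thesis using t(1) by (simp add: R_def) (auto simp: u less_Suc_eq)
    qed
    then show ?thesis
      by (intro ok_mono[OF ok_loopfree[where Q = "R i (Suc j)"]]) (auto simp: csa_init_lens_body_def)
  qed
  have lens_loop: "ok (R i e) (e * (7 + 2) + 1) (WHILE Lt (Var J) (Var NumArcs) DO csa_init_lens_body) t"
    if t: "R i 0 t" "i < k" for i t
  proof (rule ok_for[where P = "R i", OF t(1)])
    show "bval (Lt (Var J) (Var NumArcs)) u \<longleftrightarrow> j < e" if "R i j u" for j u
      using that static(2)[of u] s by (simp add: R_def)
  qed (use lens t in auto)
  have upd: "P (Suc i) (t(InU := (t InU)(i := 1), I := (t I)(0 := Suc i)))"
    if t: "R i e t" "i < k" for i t
  proof -
    \<comment> \<open>With all arcs scanned, the conditionals in \<open>R\<close> give the true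
      lengths: by \<open>A(2)\<close> and \<open>B(2)\<close> a length without a matching arc is
      0.\<close>
    have "t A i = a i" "t B i = b i"
      using t A(2)[of i] B(2)[of i] by (auto simp: R_def MA_def MB_def)
    then have "D i (t(InU := (t InU)(i := 1), I := (t I)(0 := Suc i)))"
      using t by (simp add: D_def R_def walk_stored_def)
    moreover have "D i' (t(InU := (t InU)(i := 1), I := (t I)(0 := Suc i)))" if "i' < i" for i'
      by (rule D_cong[of i' t]) (use that t(1) in \<open>auto simp: R_def\<close>)
    ultimately show ?thesis
      using t by (simp add: P_def R_def X_def less_Suc_eq del: fun_upd_apply) (simp add: Suc_le_eq)
  qed
  have body: "ok (P (Suc i)) (Suc (13 + (e * (7 + 2) + 1)) + 2 + 2)
       (csa_init_walk;;
       WHILE Lt (Var J) (Var NumArcs) DO csa_init_lens_body;;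
       InU .[Var I] ::= Lit 1;;
       I ::= Add (Var I) (Lit 1)) t" if t: "P i t" "i < k" for i t
  proof (intro ok_Seq_Assign ok_mono[OF ok_Seq[OF walk[OF t] lens_loop[OF _ t(2)]] order.refl])
    fix u assume u: "R i e u"
    then have "u I 0 = i" by (simp add: R_def)
    with upd[OF u t(2)] show "P (Suc i) ((u(InU := (u InU)(aval (Var I) u := aval (Lit 1) u)))
        (I := ((u(InU := (u InU)(aval (Var I) u := aval (Lit 1) u))) I)
          (aval (Lit 0) (u(InU := (u InU)(aval (Var I) u := aval (Lit 1) u))) :=
           aval (Add (Var I) (Lit 1)) (u(InU := (u InU)(aval (Var I) u := aval (Lit 1) u))))))"
      by simp
  qed
  have "ok (P k) (k * (Suc (13 + (e * (7 + 2) + 1)) + 2 + 2 + 2) + 1) (WHILE Lt (Var I) (Var NumDemands) DO (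
       csa_init_walk;;
       WHILE Lt (Var J) (Var NumArcs) DO csa_init_lens_body;;
       InU .[Var I] ::= Lit 1;;
       I ::= Add (Var I) (Lit 1))) t" if t: "P 0 t" for t
  proof (rule ok_for[where P = P, OF t])
    show "bval (Lt (Var I) (Var NumDemands)) u \<longleftrightarrow> i < k" if "P i u" for i u
      using that static(3)[of u] s by (simp add: P_def)
  qed (rule body)
  moreover have "ok (P 0) 1 (I ::= Lit 0) s"
    by (rule ok_mono[OF ok_loopfree[where Q = "P 0"]]) (use zero in \<open>auto simp: P_def X_def\<close>)
  ultimately have "ok (P k) (Suc (1 + (k * (Suc (13 + (e * (7 + 2) + 1)) + 2 + 2 + 2) + 1)))
     (I ::= Lit 0;; WHILE Lt (Var I) (Var NumDemands) DO (
       csa_init_walk;;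
       WHILE Lt (Var J) (Var NumArcs) DO csa_init_lens_body;;
       InU .[Var I] ::= Lit 1;;
       I ::= Add (Var I) (Lit 1))) s"
    by (rule ok_Seq[rotated])
  note loop = ok_mono[OF this order.refl]
  have fin: "agree_off {W0, W1, W2, WLen, A, B, InU, I, J, CardU, NumOcc} s u \<and>
           u CardU 0 = k \<and> u NumOcc 0 = 0 \<and>
           (\<forall>i<k. u A i = a i \<and> u B i = b i \<and> u InU i = 1 \<and> walk_stored c (s Src i) (s Dst i) i u)"
    if "P k t" "u = t(CardU := (t CardU)(0 := k), NumOcc := (t NumOcc)(0 := 0))" for t u
  proof -
    have "D i u" if "i < k" for i
      by (rule D_cong[of i t]) (use that \<open>P k t\<close> in \<open>auto simp: P_def \<open>u = _\<close>\<close>)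
    moreover have "agree_off {W0, W1, W2, WLen, A, B, InU, I, J, CardU, NumOcc} s u"
      using that by (auto simp: P_def X_def agree_off_def)
    ultimately show ?thesis using that(2) by (simp add: D_def)
  qed
  have nd: "t NumDemands 0 = k" if "P k t" for t
    using that static(3)[of t] s by (simp add: P_def)
  show ?thesis
    unfolding csa_init_alt
    by (rule ok_mono[OF ok_Seq_Assign[OF ok_Seq_Assign[OF loop]]])
      (auto dest!: fin simp: nd)
qed

section \<open>Simulation between the main loop and the abstract algorithm\<close>

lemma csa_loop_ok:
  assumes s0: "s0 NumDemands 0 = k" "\<And>i. i < k \<Longrightarrow> s0 A i = a i" "\<And>i. i < k \<Longrightarrow> s0 B i = b i"
    and inv: "csa_inv s0 k ({..<k}, {}, \<lambda>_. 0) s"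
  shows "ok (\<lambda>t. \<exists>X d. (csa_step a b)\<^sup>*\<^sup>* ({..<k}, {}, \<lambda>_. 0) ({}, X, d) \<and> csa_inv s0 k ({}, X, d) t)
           (k * (Suc (Suc ((k * 8 + 5) + ((k + 1) * (k * 6 + 10) + 5)) + (k * 12 + 5)) + 10 + 2) + 1)
           (WHILE Lt (Lit 0) (Var CardU) DO csa_body) s"
proof -
  \<comment> \<open>The abstract state is existential because it follows whichever demand the
    program picks; \<open>card U + i = k\<close> makes the number of iterations exactly
    \<open>k\<close>.\<close>
  define P where "P i t \<longleftrightarrow> (\<exists>U X d. (csa_step a b)\<^sup>*\<^sup>* ({..<k}, {}, \<lambda>_. 0) (U, X, d) \<and>
    csa_inv s0 k (U, X, d) t \<and> card U + i = k)" for i t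
  have "ok (P k)
           (k * (Suc (Suc ((k * 8 + 5) + ((k + 1) * (k * 6 + 10) + 5)) + (k * 12 + 5)) + 10 + 2) + 1)
           (WHILE Lt (Lit 0) (Var CardU) DO csa_body) s"
  proof (rule ok_for)
    show "P 0 s" unfolding P_def using inv by (intro exI conjI) auto
    show "bval (Lt (Lit 0) (Var CardU)) t \<longleftrightarrow> i < k" if "P i t" for i t
      using that by (auto simp: P_def)
    show "ok (P (Suc i)) (Suc (Suc ((k * 8 + 5) + ((k + 1) * (k * 6 + 10) + 5)) + (k * 12 + 5)) + 10)
            csa_body t" if "P i t" "i < k" for i t
    proof -
      from that obtain U X d where run: "(csa_step a b)\<^sup>*\<^sup>* ({..<k}, {}, \<lambda>_. 0) (U, X, d)"
        and t: "csa_inv s0 k (U, X, d) t" and card: "card U + i = k" by (auto simp: P_def)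
      have "U \<noteq> {}" "finite U" using card that(2) t finite_subset[of U "{..<k}"] by auto
      define \<sigma> where "\<sigma> = (LEAST v. Min (a ` U) \<le> v \<and> v \<notin> X)"
      show ?thesis
      proof (rule csa_body_ok[OF csa_select_ok_can(1)[OF t \<open>U \<noteq> {}\<close> s0 HOL.refl \<sigma>_def]])
        fix u assume u: "agree_off {Min_A, Slot, Best, Found, I, J} t u \<and> u Slot 0 = \<sigma> \<and> u Best 0 \<in> U \<and>
          a (u Best 0) \<le> \<sigma> \<and> (\<forall>j\<in>U. a j \<le> \<sigma> \<longrightarrow> b j \<le> b (u Best 0))"
        then have "csa_step a b (U, X, d)
            (U - {u Best 0}, insert \<sigma> X, d(u Best 0 := \<sigma> - a (u Best 0)))"
          using \<open>U \<noteq> {}\<close> by (intro csa_step.intros[OF _ HOL.refl \<sigma>_def]) auto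
        with run have "(csa_step a b)\<^sup>*\<^sup>* ({..<k}, {}, \<lambda>_. 0)
            (U - {u Best 0}, insert \<sigma> X, d(u Best 0 := \<sigma> - a (u Best 0)))"
          by (rule rtranclp.rtrancl_into_rtrancl)
        moreover have "csa_inv s0 k (U - {u Best 0}, insert \<sigma> X, d(u Best 0 := \<sigma> - a (u Best 0)))
            (csa_update u)"
          using u s0(2) by (intro csa_inv_update[OF t]) auto
        moreover have "card (U - {u Best 0}) + Suc i = k"
          using u card card_Suc_Diff1[OF \<open>finite U\<close>, of "u Best 0"] by simp
        ultimately show "P (Suc i) (csa_update u)" unfolding P_def by blast
      qed
    qed
  qed
  moreover have "\<exists>X d. (csa_step a b)\<^sup>*\<^sup>* ({..<k}, {}, \<lambda>_. 0) ({}, X, d) \<and> csa_inv s0 k ({}, X, d) t"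
    if P: "P k t" for t
  proof -
    from P obtain U X d where U: "(csa_step a b)\<^sup>*\<^sup>* ({..<k}, {}, \<lambda>_. 0) (U, X, d)"
      "csa_inv s0 k (U, X, d) t" "card U = 0" by (auto simp: P_def)
    then have "U = {}" using finite_subset[of U "{..<k}"] by auto
    with U show ?thesis by blast
  qed
  ultimately show ?thesis by (rule ok_mono[OF _ order.refl])
qed

text \<open>The induction peels off the first step of the abstract run, hence the arbitrary state
  \<open>st\<close>; in each iteration the program is steered to the demand that the run
  selects.\<close>

lemma csa_loop_can:
  assumes s0: "s0 NumDemands 0 = k" "\<And>i. i < k \<Longrightarrow> s0 A i = a i" "\<And>i. i < k \<Longrightarrow> s0 B i = b i"
    and run: "(csa_step a b)\<^sup>*\<^sup>* st ({}, X', d')" and inv: "csa_inv s0 k st s"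
  shows "can (csa_inv s0 k ({}, X', d')) (WHILE Lt (Lit 0) (Var CardU) DO csa_body) s"
  using run inv
proof (induction arbitrary: s rule: converse_rtranclp_induct)
  case base
  then show ?case by (intro can_while_end) auto
next
  case (step st st')
  from step.hyps(1) obtain U X d m \<sigma> i
    where st: "st = (U, X, d)" "st' = (U - {i}, insert \<sigma> X, d(i := \<sigma> - a i))"
      and U: "U \<noteq> {}" and m: "m = Min (a ` U)" and \<sigma>: "\<sigma> = (LEAST v. m \<le> v \<and> v \<notin> X)"
      and i: "i \<in> U" "a i \<le> \<sigma>" "\<forall>j\<in>U. a j \<le> \<sigma> \<longrightarrow> b j \<le> b i"
    by (cases rule: csa_step.cases) blast
  have s: "csa_inv s0 k (U, X, d) s" using step.prems by (simp only: st)
  show ?case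
  proof (rule can_while_step)
    have "finite U" using s finite_subset[of U "{..<k}"] by auto
    then show "bval (Lt (Lit 0) (Var CardU)) s" using s U by (simp add: card_gt_0_iff)
    show "can (csa_inv s0 k st') csa_body s"
    proof (rule csa_body_can[OF csa_select_ok_can(2)[OF s U s0 m \<sigma> i]])
      fix u assume "agree_off {Min_A, Slot, Best, Found, I, J} s u \<and> u Slot 0 = \<sigma> \<and> u Best 0 = i"
      then show "csa_inv s0 k st' (csa_update u)"
        unfolding st using i(1) s0(2) by (intro csa_inv_update[OF s]) auto
    qed
  qed (rule step.IH)
qed

text \<open>Initialisation plus \<open>k\<close> iterations, left unsimplified so that the budget
  produced by \<open>ok_Seq\<close> matches it literally.\<close>

definition csa_nsteps :: "nat \<Rightarrow> nat \<Rightarrow> nat" where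
  "csa_nsteps e k = Suc (k * (e * 9 + 21) + 7 +
     (k * (Suc (Suc ((k * 8 + 5) + ((k + 1) * (k * 6 + 10) + 5)) + (k * 12 + 5)) + 10 + 2) + 1))"

lemma csa_nsteps_mono: "e \<le> e' \<Longrightarrow> k \<le> k' \<Longrightarrow> csa_nsteps e k \<le> csa_nsteps e' k'"
  unfolding csa_nsteps_def by (intro Suc_le_mono[THEN iffD2] add_le_mono mult_le_mono) auto

text \<open>Speaks of memories and functions \<open>a\<close>, \<open>b\<close> only, without graphs
  or encodings. \<open>Delay\<close> must start at 0 to agree with the initial delays of the
  abstract run.\<close>

lemma csa_prog_ok_can:
  fixes s :: "reg mem"
  assumes s: "s Centre 0 = c" "s NumArcs 0 = e" "s NumDemands 0 = k"
    and zero: "\<And>i. i < k \<Longrightarrow> s A i = 0 \<and> s B i = 0" "\<And>i. s Delay i = 0"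
    and A: "\<And>i j. i < k \<Longrightarrow> j < e \<Longrightarrow> s Tail j = s Src i \<Longrightarrow> s Head j = c \<Longrightarrow> s Len j = a i"
      "\<And>i. i < k \<Longrightarrow> a i \<noteq> 0 \<Longrightarrow> \<exists>j<e. s Tail j = s Src i \<and> s Head j = c"
    and B: "\<And>i j. i < k \<Longrightarrow> j < e \<Longrightarrow> s Tail j = c \<Longrightarrow> s Head j = s Dst i \<Longrightarrow> s Len j = b i"
      "\<And>i. i < k \<Longrightarrow> b i \<noteq> 0 \<Longrightarrow> \<exists>j<e. s Tail j = c \<and> s Head j = s Dst i"
  defines "Q \<equiv> (\<lambda>d t. \<forall>i<k. t Delay i = d i \<and> walk_stored c (s Src i) (s Dst i) i t)"
  shows "ok (\<lambda>t. \<exists>X d. (csa_step a b)\<^sup>*\<^sup>* ({..<k}, {}, \<lambda>_. 0) ({}, X, d) \<and> Q d t) (csa_nsteps e k) csa_prog s"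
    and "(csa_step a b)\<^sup>*\<^sup>* ({..<k}, {}, \<lambda>_. 0) ({}, X, d) \<Longrightarrow> can (Q d) csa_prog s"
proof -
  define P where "P t \<longleftrightarrow> agree_off {W0, W1, W2, WLen, A, B, InU, I, J, CardU, NumOcc} s t \<and>
           t CardU 0 = k \<and> t NumOcc 0 = 0 \<and>
           (\<forall>i<k. t A i = a i \<and> t B i = b i \<and> t InU i = 1 \<and> walk_stored c (s Src i) (s Dst i) i t)" for t
  have init: "ok P (k * (e * 9 + 21) + 7) csa_init s"
    unfolding P_def by (rule csa_init_ok) (use assms in auto)
  have P: "t NumDemands 0 = k" "i < k \<Longrightarrow> t A i = a i" "i < k \<Longrightarrow> t B i = b i"
    "csa_inv t k ({..<k}, {}, \<lambda>_. 0) t" if t: "P t" for t i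
  proof -
    have ag: "agree_off {W0, W1, W2, WLen, A, B, InU, I, J, CardU, NumOcc} s t"
      using t by (simp add: P_def)
    show "t NumDemands 0 = k" using agree_offD[OF ag] s by simp
    have "t Delay = s Delay" using agree_offD[OF ag] by simp
    then show "csa_inv t k ({..<k}, {}, \<lambda>_. 0) t" using t zero by (simp add: P_def)
  qed (use that in \<open>auto simp: P_def\<close>)
  have Q: "Q d' u" if "P t" "csa_inv t k ({}, X', d') u" for t u X' d'
  proof -
    have ag: "agree_off {Delay, InU, CardU, Occ, NumOcc, Min_A, Slot, Best, Found, I, J} t u"
      using that(2) by simp
    show ?thesis
      using that agree_offD[OF ag, of W0] agree_offD[OF ag, of W1] agree_offD[OF ag, of W2]
        agree_offD[OF ag, of WLen]
      by (simp add: P_def Q_def walk_stored_def)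
  qed
  show "ok (\<lambda>t. \<exists>X d. (csa_step a b)\<^sup>*\<^sup>* ({..<k}, {}, \<lambda>_. 0) ({}, X, d) \<and> Q d t) (csa_nsteps e k) csa_prog s"
    unfolding csa_prog_alt csa_nsteps_def
  proof (rule ok_Seq[OF init])
    fix t assume t: "P t"
    show "ok (\<lambda>t. \<exists>X d. (csa_step a b)\<^sup>*\<^sup>* ({..<k}, {}, \<lambda>_. 0) ({}, X, d) \<and> Q d t)
     (k * (Suc (Suc ((k * 8 + 5) + ((k + 1) * (k * 6 + 10) + 5)) + (k * 12 + 5)) + 10 + 2) + 1)
     (WHILE Lt (Lit 0) (Var CardU) DO csa_body) t"
    proof (rule ok_mono[OF csa_loop_ok[OF P[OF t]] order.refl])
      fix u
      assume "\<exists>X d. (csa_step a b)\<^sup>*\<^sup>* ({..<k}, {}, \<lambda>_. 0) ({}, X, d) \<and> csa_inv t k ({}, X, d) u"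
      then obtain X d where "(csa_step a b)\<^sup>*\<^sup>* ({..<k}, {}, \<lambda>_. 0) ({}, X, d)" "csa_inv t k ({}, X, d) u"
        by (elim exE conjE)
      with Q[OF t this(2)] show "\<exists>X d. (csa_step a b)\<^sup>*\<^sup>* ({..<k}, {}, \<lambda>_. 0) ({}, X, d) \<and> Q d u"
        by (intro exI conjI)
    qed
  qed
  show "can (Q d) csa_prog s"
    if run: "(csa_step a b)\<^sup>*\<^sup>* ({..<k}, {}, \<lambda>_. 0) ({}, X, d)"
    unfolding csa_prog_alt
  proof (rule can_Seq[OF can_if_ok[OF init]])
    fix t assume t: "P t"
    show "can (Q d) (WHILE Lt (Lit 0) (Var CardU) DO csa_body) t"
      by (rule can_mono[OF csa_loop_can[OF P(1-3)[OF t] run P(4)[OF t]] Q[OF t]])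
  qed
qed

section \<open>Optimality\<close>

text \<open>The loop is never stuck: a demand of least release date is released by \<sigma>, and a
  finite nonempty set of released demands has a maximiser of \<open>b\<close>. So statements about
  all outputs are not vacuous.\<close>

lemma csa_step_final_exists:
  assumes "finite U" "finite X"
  shows "\<exists>X' d'. (csa_step a b)\<^sup>*\<^sup>* (U, X, d) ({}, X', d')"
  using assms
proof (induction "card U" arbitrary: U X d)
  case 0
  then show ?case by auto
next
  case (Suc n)
  then have "U \<noteq> {}" by auto
  define \<sigma> where "\<sigma> = (LEAST v. Min (a ` U) \<le> v \<and> v \<notin> X)"
  define E where "E = {j \<in> U. a j \<le> \<sigma>}"
  have "Min (a ` U) \<in> a ` U" using \<open>U \<noteq> {}\<close> Suc.prems by (intro Min_in) auto
  then have "E \<noteq> {}" "finite E"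
    using Least_not_in(1)[OF Suc.prems(2) \<sigma>_def] Suc.prems by (auto simp: E_def)
  then have "Max (b ` E) \<in> b ` E" by (intro Max_in) auto
  then obtain i where i: "i \<in> E" "b i = Max (b ` E)" by auto
  then have "\<forall>j\<in>U. a j \<le> \<sigma> \<longrightarrow> b j \<le> b i" using \<open>finite E\<close> by (auto simp: E_def)
  with i(1) \<open>U \<noteq> {}\<close> have step: "csa_step a b (U, X, d) (U - {i}, insert \<sigma> X, d(i := \<sigma> - a i))"
    by (intro csa_step.intros[OF _ HOL.refl \<sigma>_def]) (auto simp: E_def)
  have "n = card (U - {i})" using Suc i(1) by (simp add: E_def)
  from Suc.hyps(1)[OF this, of "insert \<sigma> X" "d(i := \<sigma> - a i)"] Suc.prems
  obtain X' d' where "(csa_step a b)\<^sup>*\<^sup>* (U - {i}, insert \<sigma> X, d(i := \<sigma> - a i)) ({}, X', d')" by auto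
  with step show ?case by (meson converse_rtranclp_into_rtranclp)
qed

text \<open>
  Exchange argument: given a schedule that agrees with the slots chosen so far, move the demand
  selected next to its slot \<open>\<sigma>\<close>, and the demand that occupied \<open>\<sigma>\<close>, if any, to the slot freed.
\<close>

lemma csa_exchange:
  fixes f :: "nat \<Rightarrow> nat"
  assumes step: "csa_step a b (U, X, d) (U', X', d')"
    and fin: "finite K" "U \<subseteq> K" and X: "X = (\<lambda>j. d j + a j) ` (K - U)"
    and f: "inj_on f K" "\<And>j. j \<in> K \<Longrightarrow> a j \<le> f j" "\<And>j. j \<in> K \<Longrightarrow> f j + b j \<le> C"
      "\<And>j. j \<in> K - U \<Longrightarrow> f j = d j + a j"
  shows "\<exists>f'. inj_on f' K \<and> (\<forall>j\<in>K. a j \<le> f' j \<and> f' j + b j \<le> C) \<and>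
           (\<forall>j\<in>K - U'. f' j = d' j + a j)"
  using step
proof (cases rule: csa_step.cases)
  case (1 m \<sigma> i)
  have "finite X" using fin X by auto
  note \<sigma> = Least_not_in[OF this 1(6)]
  have "i \<in> K" using 1(7) fin by auto
  have "finite U" using fin finite_subset by blast
  \<comment> \<open>The crucial point: the slots from \<open>m\<close> to
    \<open>\<sigma> - 1\<close> are held by fixed demands, on which \<open>f\<close> agrees with the
    algorithm, so injectivity bars them for \<open>j\<close>, while
    \<open>m \<le> a j \<le> f j\<close>.\<close>
  have ge: "\<sigma> \<le> f j" if j: "j \<in> U" for j
  proof -
    have "m \<le> a j" using j \<open>finite U\<close> by (simp add: 1(5))
    also have "\<dots> \<le> f j" using j fin f(2) by auto
    finally have "m \<le> f j" .
    moreover have "f j \<notin> X"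
    proof
      assume "f j \<in> X"
      then obtain l where l: "l \<in> K - U" "f j = d l + a l" unfolding X by blast
      then have "f j = f l" using f(4) by simp
      then have "j = l" using inj_onD[OF f(1)] j l(1) fin(2) by blast
      with j l(1) show False by blast
    qed
    ultimately show ?thesis using \<sigma>(3)[of "f j"] by (meson not_le)
  qed
  have old: "f j \<noteq> \<sigma>" if "j \<in> K - U" for j
    using that f(4)[OF that] \<sigma>(2) unfolding X by force
  \<comment> \<open>The truncated subtraction in \<open>d'\<close> is exact because
    \<open>a i \<le> \<sigma>\<close>.\<close>
  have d': "d' j + a j = (if j = i then \<sigma> else d j + a j)" for j
    using 1 by auto
  show ?thesis
  proof (cases "\<exists>l\<in>K. f l = \<sigma>")
    case False
    define f' where "f' = f(i := \<sigma>)"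
    have "inj_on f' K" using f(1) False by (auto simp: f'_def inj_on_def)
    moreover have "\<sigma> + b i \<le> C" using ge[OF 1(7)] f(3)[OF \<open>i \<in> K\<close>] by linarith
    moreover have "f' j = d' j + a j" if "j \<in> K - U'" for j
      using that f(4) 1(1) d' by (auto simp: f'_def)
    ultimately show ?thesis using f(2,3) 1(8)
      by (intro exI[of _ f'] conjI ballI) (auto simp: f'_def)
  next
    case True
    then obtain l where l: "l \<in> K" "f l = \<sigma>" by blast
    with old have "l \<in> U" by auto
    \<comment> \<open>If \<open>l = i\<close>, the second update restores \<sigma> and
      \<open>f'\<close> is \<open>f\<close>, so a demand already in its slot needs no separate
      case.\<close>
    define f' where "f' = f(l := f i, i := \<sigma>)"
    have "inj_on f' K"
      using l(1) \<open>i \<in> K\<close> unfolding f'_def inj_on_def l(2)[symmetric]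
      by (auto simp: inj_on_eq_iff[OF f(1)])
    moreover have "a l \<le> \<sigma>" using f(2)[OF l(1)] l(2) by simp
    \<comment> \<open>\<open>l\<close> was itself a candidate for \<sigma>, so the greedy choice
      applies. In its new slot it costs \<open>f i + b l \<le> f i + b i \<le> C\<close>, and
      \<open>a l \<le> \<sigma> \<le> f i\<close> keeps it released.\<close>
    then have "b l \<le> b i" using 1(9) \<open>l \<in> U\<close> by auto
    moreover have "\<sigma> \<le> f i" "f i + b i \<le> C" using ge[OF 1(7)] f(3)[OF \<open>i \<in> K\<close>] by auto
    moreover have "f' j = d' j + a j" if "j \<in> K - U'" for j
      using that \<open>l \<in> U\<close> f(4) 1(1) d' by (auto simp: f'_def)
    ultimately show ?thesis using f(2,3) \<open>a l \<le> \<sigma>\<close> 1(8)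
      by (intro exI[of _ f'] conjI ballI) (auto simp: f'_def)
  qed
qed

text \<open>Quantifying over \<open>f\<close> and \<open>C\<close> inside the induction compares one
  run with all schedules at once. At \<open>U = {}\<close> the schedule \<open>f'\<close> is that of
  the algorithm on all of \<open>K\<close>, so the latter meets every bound met by some schedule;
  the injectivity carried along gives feasibility.\<close>

lemma csa_run_exchange:
  assumes "(csa_step a b)\<^sup>*\<^sup>* (K, {}, d0) (U, X, d)" and K: "finite K"
  shows "U \<subseteq> K \<and> X = (\<lambda>j. d j + a j) ` (K - U) \<and> inj_on (\<lambda>j. d j + a j) (K - U) \<and>
    (\<forall>f C. inj_on f K \<longrightarrow> (\<forall>j\<in>K. a j \<le> f j \<and> f j + b j \<le> C) \<longrightarrow>
       (\<exists>f'. inj_on f' K \<and> (\<forall>j\<in>K. a j \<le> f' j \<and> f' j + b j \<le> C) \<and>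
           (\<forall>j\<in>K - U. f' j = d j + a j)))"
  using assms(1)
proof (induction "(U, X, d)" arbitrary: U X d rule: rtranclp_induct)
  case base
  then show ?case by auto
next
  case (step st)
  obtain U1 X1 d1 where st: "st = (U1, X1, d1)" by (cases st)
  note IH = step.hyps(3)[OF st]
  from IH have IH': "U1 \<subseteq> K" "X1 = (\<lambda>j. d1 j + a j) ` (K - U1)" "inj_on (\<lambda>j. d1 j + a j) (K - U1)"
    by auto
  from step.hyps(2) obtain \<sigma> i m where U: "U = U1 - {i}" "X = insert \<sigma> X1" "d = d1(i := \<sigma> - a i)"
    and \<sigma>: "\<sigma> = (LEAST v. m \<le> v \<and> v \<notin> X1)" and i: "i \<in> U1" "a i \<le> \<sigma>"
    unfolding st by (cases rule: csa_step.cases) blast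
  have "finite X1" using IH'(2) K by auto
  note notin = Least_not_in(2)[OF this \<sigma>]
  have KU: "K - U = insert i (K - U1)" using U i IH' by auto
  have eq: "d j + a j = (if j = i then \<sigma> else d1 j + a j)" for j using U i by auto
  have img: "(\<lambda>j. d j + a j) ` (K - U1) = X1"
    unfolding IH'(2) using i(1) by (intro image_cong) (auto simp: eq)
  have "inj_on (\<lambda>j. d j + a j) (K - U1)"
    using IH'(3) i(1) by (subst inj_on_cong[where g = "\<lambda>j. d1 j + a j"]) (auto simp: eq)
  then have "inj_on (\<lambda>j. d j + a j) (K - U)"
    unfolding KU using i(1) notin img by (simp add: eq[of i])
  moreover have "X = (\<lambda>j. d j + a j) ` (K - U)"
    unfolding KU image_insert img by (simp add: U(2) eq[of i])
  moreover have "\<exists>f'. inj_on f' K \<and> (\<forall>j\<in>K. a j \<le> f' j \<and> f' j + b j \<le> C) \<and>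
           (\<forall>j\<in>K - U. f' j = d j + a j)"
    if "inj_on f K" "\<forall>j\<in>K. a j \<le> f j \<and> f j + b j \<le> C" for f C
  proof -
    from IH that obtain g where "inj_on g K" "\<forall>j\<in>K. a j \<le> g j \<and> g j + b j \<le> C"
      "\<forall>j\<in>K - U1. g j = d1 j + a j" by blast
    then show ?thesis
      using csa_exchange[OF step.hyps(2)[unfolded st] K IH'(1,2), of g C] by blast
  qed
  ultimately show ?case using IH'(1) U(1) by blast
qed

section \<open>Solutions in an oriented star as slot assignments\<close>

context star_instance
begin

abbreviation "src i \<equiv> fst (T ! i)"
abbreviation "dst i \<equiv> snd (T ! i)"

lemma src_inj: "i < length T \<Longrightarrow> j < length T \<Longrightarrow> src i = src j \<Longrightarrow> i = j"
  using demands_unique nth_eq_iff_index_eq[of "map fst T" i j] by simp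

lemma dst_inj: "i < length T \<Longrightarrow> j < length T \<Longrightarrow> dst i = dst j \<Longrightarrow> i = j"
  using demands_unique nth_eq_iff_index_eq[of "map snd T" i j] by simp

lemma src_neq_dst:
  assumes "i < length T" "j < length T"
  shows "src i \<noteq> dst j"
proof -
  have "src i \<in> set (map fst T)" "dst j \<in> set (map snd T)" using assms by simp_all
  moreover have "set (map fst T) \<inter> set (map snd T) = {}"
    using demands_unique by (simp only: distinct_append)
  ultimately show ?thesis by (metis disjoint_iff)
qed

lemma arc_star: "(u, v) \<in> parcs G \<Longrightarrow> (u = x) \<noteq> (v = x)"
  using star by (auto simp: oriented_star_def)

lemma arc_in_out: "(u, x) \<in> parcs G \<Longrightarrow> (x, u) \<notin> parcs G"
proof -
  assume u: "(u, x) \<in> parcs G"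
  then have "u \<noteq> x" "u \<in> pverts G" using arc_star wellformed(1)[of "(u, x)"] by auto
  then show ?thesis using u star by (auto simp: oriented_star_def)
qed

text \<open>A leaf has a single arc: a walk entering a leaf ends there, and a walk leaving a leaf
  goes to \<open>x\<close>. The assumption \<open>s \<noteq> t\<close> excludes the walk with one
  vertex.\<close>

lemma walk_unique:
  assumes "walk_from_to G s t W" "s \<noteq> t"
  shows "W = (if s = x \<or> t = x then [s, t] else [s, x, t])" and "set (vwalk_arcs W) \<subseteq> parcs G"
proof -
  have W: "vwalk W (with_proj G)" "hd W = s" "last W = t"
    using assms(1) by (auto simp: walk_from_to_def)
  then show arcs: "set (vwalk_arcs W) \<subseteq> parcs G" by (auto simp: vwalk_def)
  have "W \<noteq> []" using W(1) by auto
  then obtain W1 where W1: "W = s # W1" using W(2) by (cases W) auto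
  have "W1 \<noteq> []" using W(3) assms(2) W1 by auto
  then obtain v W2 where W2: "W1 = v # W2" by (cases W1) auto
  show "W = (if s = x \<or> t = x then [s, t] else [s, x, t])"
  proof (cases W2)
    case Nil
    then show ?thesis using W(3) W1 W2 arcs arc_star[of s v] by auto
  next
    case (Cons w W3)
    have sv: "(s, v) \<in> parcs G" "(v, w) \<in> parcs G" using arcs by (simp_all add: W1 W2 Cons)
    have "v = x"
    proof (rule ccontr)
      assume "v \<noteq> x"
      then have "s = x" "w = x" using arc_star sv by auto
      then show False using sv arc_in_out by auto
    qed
    then have neq: "s \<noteq> x" "w \<noteq> x" using arc_star sv by auto
    show ?thesis
    proof (cases W3)
      case Nil
      then show ?thesis using W(3) neq \<open>v = x\<close> by (simp add: W1 W2 Cons)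
    next
      case (Cons y W4)
      then have "(w, y) \<in> parcs G" using arcs by (simp add: W1 W2 \<open>W2 = w # W3\<close>)
      then have "(w, x) \<in> parcs G" using arc_star[of w y] neq by auto
      then show ?thesis using sv \<open>v = x\<close> arc_in_out by auto
    qed
  qed
qed

lemma walk_iff:
  assumes "i < length T"
  shows "walk_from_to G (src i) (dst i) W \<longleftrightarrow> W = csa_walk T x i"
proof -
  have neq: "src i \<noteq> dst i" using src_neq_dst assms by blast
  have "(src i, dst i) \<in> set T" using assms by simp
  then obtain W0 where W0: "walk_from_to G (src i) (dst i) W0" using demands_connected by blast
  have eq: "W = csa_walk T x i" if "walk_from_to G (src i) (dst i) W" for W
    using walk_unique(1)[OF that neq] by (simp add: csa_walk_def case_prod_beta)
  show ?thesis using eq[OF W0] W0 eq by blast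
qed

text \<open>The arcs are read off from the walk that the instance guarantees for each
  demand.\<close>

lemma walk_arcs:
  assumes "i < length T"
  shows "src i \<noteq> x \<Longrightarrow> (src i, x) \<in> parcs G" "dst i \<noteq> x \<Longrightarrow> (x, dst i) \<in> parcs G"
proof -
  have neq: "src i \<noteq> dst i" using src_neq_dst assms by blast
  have "(src i, dst i) \<in> set T" using assms by simp
  then obtain W where W: "walk_from_to G (src i) (dst i) W" using demands_connected by blast
  have "set (vwalk_arcs (if src i = x \<or> dst i = x then [src i, dst i] else [src i, x, dst i])) \<subseteq> parcs G"
    using walk_unique[OF W neq] by simp
  then show "src i \<noteq> x \<Longrightarrow> (src i, x) \<in> parcs G" "dst i \<noteq> x \<Longrightarrow> (x, dst i) \<in> parcs G"
    by (auto split: if_splits)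
qed

lemma csa_walk_len:
  assumes "i < length T"
  shows "walk_len lam (csa_walk T x i) = csa_a lam T x i + csa_b lam T x i"
  using src_neq_dst[OF assms assms]
  by (auto simp: walk_len_def len_upto_def csa_walk_def csa_a_def csa_b_def case_prod_beta
      numeral_2_eq_2)

lemma csa_walk_centre:
  assumes "i < length T"
  shows "\<exists>p<length (csa_walk T x i). csa_walk T x i ! p = x"
    and "p < length (csa_walk T x i) \<Longrightarrow> csa_walk T x i ! p = x \<Longrightarrow>
           len_upto lam (csa_walk T x i) p = csa_a lam T x i"
proof -
  have neq: "src i \<noteq> dst i" using src_neq_dst assms by blast
  show "\<exists>p<length (csa_walk T x i). csa_walk T x i ! p = x"
    using in_set_conv_nth[of x "csa_walk T x i"] by (auto simp: csa_walk_def case_prod_beta)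
  show "len_upto lam (csa_walk T x i) p = csa_a lam T x i"
    if "p < length (csa_walk T x i)" "csa_walk T x i ! p = x"
    using that neq
    by (auto simp: csa_walk_def csa_a_def len_upto_def case_prod_beta less_Suc_eq split: if_splits)
qed

lemma csa_walk_common:
  assumes "i < length T" "j < length T" "i \<noteq> j" "v \<in> set (csa_walk T x i)" "v \<in> set (csa_walk T x j)"
  shows "v = x"
  using assms src_inj[of i j] dst_inj[of i j] src_neq_dst[of i j] src_neq_dst[of j i]
  by (auto simp: csa_walk_def case_prod_beta split: if_splits)

lemma time_disjoint_iff:
  assumes ij: "i < length T" "j < length T" "i \<noteq> j"
  shows "time_disjoint lam (d, csa_walk T x i) (d', csa_walk T x j) \<longleftrightarrow>
    d + csa_a lam T x i \<noteq> d' + csa_a lam T x j"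
proof
  assume td: "time_disjoint lam (d, csa_walk T x i) (d', csa_walk T x j)"
  obtain p q where "p < length (csa_walk T x i)" "csa_walk T x i ! p = x"
    "q < length (csa_walk T x j)" "csa_walk T x j ! q = x"
    using csa_walk_centre(1) ij by blast
  then show "d + csa_a lam T x i \<noteq> d' + csa_a lam T x j"
    using td[unfolded time_disjoint_def fst_conv snd_conv, rule_format, of p q]
      csa_walk_centre(2)[OF ij(1), of p] csa_walk_centre(2)[OF ij(2), of q] by simp
next
  assume neq: "d + csa_a lam T x i \<noteq> d' + csa_a lam T x j"
  show "time_disjoint lam (d, csa_walk T x i) (d', csa_walk T x j)"
    unfolding time_disjoint_def fst_conv snd_conv
  proof (intro allI impI)
    fix p q assume p: "p < length (csa_walk T x i)" and q: "q < length (csa_walk T x j)"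
      and eq: "csa_walk T x i ! p = csa_walk T x j ! q"
    have "csa_walk T x i ! p = x"
      using csa_walk_common[OF ij nth_mem[OF p]] nth_mem[OF q] eq by simp
    then show "d + len_upto lam (csa_walk T x i) p \<noteq> d' + len_upto lam (csa_walk T x j) q"
      using neq csa_walk_centre(2) ij p q eq by simp
  qed
qed

text \<open>The reduction to scheduling: forced walks leave only the delays free, and time
  disjointness compares arrival times at the centre alone. The release condition is implicit, since
  delays are natural numbers.\<close>

lemma feasible_iff:
  "feasible G lam T sol \<longleftrightarrow>
     (\<exists>d. sol = map (\<lambda>i. (d i, csa_walk T x i)) [0..<length T] \<and>
          inj_on (\<lambda>i. d i + csa_a lam T x i) {..<length T})"
proof
  assume sol: "feasible G lam T sol"
  define d where "d i = fst (sol ! i)" for i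
  have walks: "snd (sol ! i) = csa_walk T x i" if "i < length T" for i
    using sol that walk_iff[OF that, of "snd (sol ! i)"] by (simp add: feasible_def)
  then have nth: "sol ! i = (d i, csa_walk T x i)" if "i < length T" for i
    using that by (simp add: d_def prod_eq_iff)
  have "sol = map (\<lambda>i. (d i, csa_walk T x i)) [0..<length T]"
    using sol nth by (intro nth_equalityI) (simp_all add: feasible_def)
  moreover have "inj_on (\<lambda>i. d i + csa_a lam T x i) {..<length T}"
  proof (rule inj_onI, rule ccontr)
    fix i j
    assume ij: "i \<in> {..<length T}" "j \<in> {..<length T}" "i \<noteq> j"
      and eq: "d i + csa_a lam T x i = d j + csa_a lam T x j"
    then have "time_disjoint lam (sol ! i) (sol ! j)" using sol by (simp add: feasible_def)
    with ij eq show False using time_disjoint_iff[of i j "d i" "d j"] by (simp add: nth)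
  qed
  ultimately show "\<exists>d. sol = map (\<lambda>i. (d i, csa_walk T x i)) [0..<length T] \<and>
          inj_on (\<lambda>i. d i + csa_a lam T x i) {..<length T}" by blast
next
  assume "\<exists>d. sol = map (\<lambda>i. (d i, csa_walk T x i)) [0..<length T] \<and>
          inj_on (\<lambda>i. d i + csa_a lam T x i) {..<length T}"
  then obtain d where sol: "sol = map (\<lambda>i. (d i, csa_walk T x i)) [0..<length T]"
    and inj: "inj_on (\<lambda>i. d i + csa_a lam T x i) {..<length T}" by blast
  have "time_disjoint lam (d i, csa_walk T x i) (d j, csa_walk T x j)"
    if "i < length T" "j < length T" "i \<noteq> j" for i j
    using that inj_onD[OF inj, of i j] by (auto simp: time_disjoint_iff)
  then show "feasible G lam T sol"
    by (simp add: feasible_def sol walk_iff)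
qed

lemma minmax_cost_le_iff:
  assumes "T \<noteq> []"
  shows "minmax_cost lam (map (\<lambda>i. (d i, csa_walk T x i)) [0..<length T]) \<le> C \<longleftrightarrow>
    (\<forall>i<length T. d i + csa_a lam T x i + csa_b lam T x i \<le> C)"
  unfolding minmax_cost_def using assms by (subst Max_le_iff) (auto simp: csa_walk_len add.assoc)

lemma csa_outputs_nonempty: "csa_outputs lam T x \<noteq> {}"
proof -
  obtain X d where "(csa_step (csa_a lam T x) (csa_b lam T x))\<^sup>*\<^sup>* ({..<length T}, {}, \<lambda>_. 0) ({}, X, d)"
    using csa_step_final_exists[of "{..<length T}" "{}"] by blast
  then show ?thesis unfolding csa_outputs_def by blast
qed

lemma csa_outputs_optimal:
  assumes "sol \<in> csa_outputs lam T x"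
  shows "minmax_optimal G lam T sol"
proof -
  let ?a = "csa_a lam T x" and ?b = "csa_b lam T x"
  from assms obtain d X where sol: "sol = map (\<lambda>i. (d i, csa_walk T x i)) [0..<length T]"
    and run: "(csa_step ?a ?b)\<^sup>*\<^sup>* ({..<length T}, {}, \<lambda>_. 0) ({}, X, d)"
    by (auto simp: csa_outputs_def)
  note exch = csa_run_exchange[OF run finite_lessThan]
  have "inj_on (\<lambda>j. d j + ?a j) {..<length T}" using exch[THEN conjunct2, THEN conjunct2, THEN conjunct1] by simp
  then have "feasible G lam T sol" unfolding feasible_iff sol by blast
  moreover have "minmax_cost lam sol \<le> minmax_cost lam sol'" if "feasible G lam T sol'" for sol'
  \<comment> \<open>Without demands the cost is the unspecified \<open>Max {}\<close>, but then both
    solutions are the empty list.\<close>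
  proof (cases "T = []")
    case True
    then show ?thesis using that sol by (auto simp: feasible_def)
  next
    case False
    from that obtain d' where sol': "sol' = map (\<lambda>i. (d' i, csa_walk T x i)) [0..<length T]"
      and inj: "inj_on (\<lambda>i. d' i + ?a i) {..<length T}" by (auto simp: feasible_iff)
    have "\<forall>i\<in>{..<length T}. ?a i \<le> d' i + ?a i \<and> d' i + ?a i + ?b i \<le> minmax_cost lam sol'"
      using minmax_cost_le_iff[OF False, of d' "minmax_cost lam sol'"] by (simp add: sol')
    from exch[THEN conjunct2, THEN conjunct2, THEN conjunct2, THEN spec, THEN spec, THEN mp, THEN mp,
        OF inj this]
    obtain f where f: "\<forall>i\<in>{..<length T}. ?a i \<le> f i \<and> f i + ?b i \<le> minmax_cost lam sol'"
      "\<forall>i\<in>{..<length T} - {}. f i = d i + ?a i" by blast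
    have "d i + ?a i + ?b i \<le> minmax_cost lam sol'" if "i < length T" for i
    proof -
      have "f i + ?b i \<le> minmax_cost lam sol'" "f i = d i + ?a i" using f that by auto
      then show ?thesis by simp
    qed
    then show ?thesis unfolding sol minmax_cost_le_iff[OF False] by blast
  qed
  ultimately show ?thesis by (simp add: minmax_optimal_def)
qed

end

section \<open>The program on encoded instances\<close>

lemma cell_cost_le_input_size:
  assumes "(v, ns) \<in> set inp" "n \<in> set ns"
  shows "num_cost n \<le> input_size inp"
proof -
  have "num_cost n \<le> (\<Sum>n\<leftarrow>ns. num_cost n)"
    using assms(2) by (intro member_le_sum_list) auto
  also have "\<dots> \<le> input_size inp"
    unfolding input_size_def using assms(1) by (intro member_le_sum_list) (force, simp)
  finally show ?thesis .
qed

text \<open>Every entry is charged at least 1, so the input size also bounds the numbers of arcs and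
  demands.\<close>

lemma length_le_input_size:
  assumes "(v, ns) \<in> set inp"
  shows "length ns \<le> input_size inp"
proof -
  have "length ns = (\<Sum>n\<leftarrow>ns. 1)" by (simp add: sum_list_triv)
  also have "\<dots> \<le> (\<Sum>n\<leftarrow>ns. num_cost n)"
    by (intro sum_list_mono) (simp add: num_cost_def)
  also have "\<dots> \<le> input_size inp"
    unfolding input_size_def using assms(1) by (intro member_le_sum_list) (force, simp)
  finally show ?thesis .
qed

lemma load_le: "load inp v i \<le> 2 ^ input_size inp"
proof (cases "\<exists>ns. map_of inp v = Some ns \<and> i < length ns")
  case True
  then obtain ns where ns: "map_of inp v = Some ns" "i < length ns" by blast
  have "ns ! i \<le> 2 ^ num_cost (ns ! i)" by (rule le_power_num_cost)
  also have "\<dots> \<le> 2 ^ input_size inp"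
    using cell_cost_le_input_size[OF map_of_SomeD[OF ns(1)] nth_mem[OF ns(2)]]
    by (intro power_increasing) auto
  finally show ?thesis using ns by (simp add: load_def)
next
  case False
  then have "load inp v i = 0" by (auto simp: load_def split: option.splits)
  then show ?thesis by simp
qed

text \<open>The witness copies the shape of \<open>csa_nsteps\<close>, with the indeterminate
  \<open>X\<close> for both arguments.\<close>

lemma csa_nsteps_poly: "\<exists>p :: nat poly. \<forall>L. poly p L = csa_nsteps L L"
proof -
  define X where "X = [:0, 1 :: nat:]"
  have X: "poly X L = L" for L by (simp add: X_def)
  show ?thesis
    by (rule exI[of _ "1 + (X * (X * 9 + 21) + 7 +
      (X * (1 + (1 + ((X * 8 + 5) + ((X + 1) * (X * 6 + 10) + 5)) + (X * 12 + 5)) + 10 + 2) + 1))"])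
      (simp add: X csa_nsteps_def)
qed

section \<open>Outputs and cost of the program on encoded instances\<close>

context star_instance
begin

context
  fixes nu :: "'v \<Rightarrow> nat" and es :: "('v \<times> 'v) list"
  assumes enc: "encoding G nu es"
begin

abbreviation "inp \<equiv> csa_input lam T x nu es"

lemma nu_eq_iff: "u \<in> pverts G \<Longrightarrow> v \<in> pverts G \<Longrightarrow> nu u = nu v \<longleftrightarrow> u = v"
  using enc by (auto simp: encoding_def dest: inj_onD)

lemma endpoints_in: "i < length T \<Longrightarrow> src i \<in> pverts G" "i < length T \<Longrightarrow> dst i \<in> pverts G"
  using demands_in nth_mem[of i T] mem_Times_iff[of "T ! i" "pverts G" "pverts G"] by blast+

lemma centre_in: "x \<in> pverts G"
  using star by (simp add: oriented_star_def)

lemma nth_arc: "j < length es \<Longrightarrow> es ! j \<in> parcs G"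
  using enc nth_mem[of j es] by (simp add: encoding_def)

lemma arc_nth: "e \<in> parcs G \<Longrightarrow> \<exists>j<length es. es ! j = e"
  using enc by (auto simp: encoding_def in_set_conv_nth[symmetric])

text \<open>\<open>nu\<close> is injective on vertices only; that the endpoints of an arc are
  vertices comes from wellformedness of \<open>G\<close>.\<close>

lemma arc_code_iff:
  assumes "j < length es" "u \<in> pverts G" "v \<in> pverts G"
  shows "nu (fst (es ! j)) = nu u \<and> nu (snd (es ! j)) = nu v \<longleftrightarrow> es ! j = (u, v)"
  using nth_arc[OF assms(1)] wellformed[of "es ! j"] assms(2,3)
  by (auto simp: nu_eq_iff prod_eq_iff)

lemma load_csa_input:
  "load inp Centre 0 = nu x" "load inp NumArcs 0 = length es" "load inp NumDemands 0 = length T"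
  "i < length T \<Longrightarrow> load inp Src i = nu (src i)" "i < length T \<Longrightarrow> load inp Dst i = nu (dst i)"
  "j < length es \<Longrightarrow> load inp Tail j = nu (fst (es ! j))"
  "j < length es \<Longrightarrow> load inp Head j = nu (snd (es ! j))"
  "j < length es \<Longrightarrow> load inp Len j = lam (es ! j)"
  "load inp A i = 0" "load inp B i = 0" "load inp Delay i = 0"
  by (simp_all add: load_def csa_input_def)

definition stored :: "(nat \<Rightarrow> nat) \<Rightarrow> reg mem \<Rightarrow> bool" where
  "stored d t \<longleftrightarrow> (\<forall>i<length T. t Delay i = d i \<and>
     walk_stored (nu x) (load inp Src i) (load inp Dst i) i t)"

lemma read_output_stored:
  assumes "stored d t"
  shows "read_output (length T) t =
    map (map_prod id (map nu)) (map (\<lambda>i. (d i, csa_walk T x i)) [0..<length T])"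
proof -
  have "take (t WLen i) [t W0 i, t W1 i, t W2 i] = map nu (csa_walk T x i)" if "i < length T" for i
    using assms that nu_eq_iff[OF endpoints_in(1)[OF that] centre_in]
      nu_eq_iff[OF endpoints_in(2)[OF that] centre_in]
    by (auto simp: stored_def walk_stored_def load_csa_input csa_walk_def case_prod_beta
        numeral_2_eq_2 numeral_3_eq_3)
  then show ?thesis using assms by (simp add: read_output_def stored_def)
qed

lemma csa_prog_run:
  fixes a b :: "nat \<Rightarrow> nat"
  defines "a \<equiv> csa_a lam T x" and "b \<equiv> csa_b lam T x"
  shows "ok (\<lambda>t. \<exists>X d. (csa_step a b)\<^sup>*\<^sup>* ({..<length T}, {}, \<lambda>_. 0) ({}, X, d) \<and> stored d t)
           (csa_nsteps (length es) (length T)) csa_prog (load inp)"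
    and "(csa_step a b)\<^sup>*\<^sup>* ({..<length T}, {}, \<lambda>_. 0) ({}, X, d) \<Longrightarrow> can (stored d) csa_prog (load inp)"
proof -
  let ?s = "load inp"
  have A: "?s Len j = a i"
    if "i < length T" "j < length es" "?s Tail j = ?s Src i" "?s Head j = nu x" for i j
  proof -
    \<comment> \<open>Equal codes identify the arc. As it is not a loop,
      \<open>src i \<noteq> x\<close>, so \<open>csa_a\<close> is in its \<open>lam\<close>
      branch.\<close>
    have "es ! j = (src i, x)"
      using that arc_code_iff[OF that(2) endpoints_in(1)[OF that(1)] centre_in]
      by (simp add: load_csa_input)
    then show ?thesis
      using that nth_arc[OF that(2)] arc_star[of "src i" x]
      by (auto simp: load_csa_input a_def csa_a_def case_prod_beta)
  qed
  have A0: "\<exists>j<length es. ?s Tail j = ?s Src i \<and> ?s Head j = nu x"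
    if i: "i < length T" and "a i \<noteq> 0" for i
  proof -
    have "(src i, x) \<in> parcs G"
      using that walk_arcs(1)[OF i] by (auto simp: a_def csa_a_def case_prod_beta split: if_splits)
    from arc_nth[OF this] obtain j where "j < length es" "es ! j = (src i, x)" by blast
    with i show ?thesis by (auto simp: load_csa_input intro!: exI[of _ j])
  qed
  have B: "?s Len j = b i"
    if "i < length T" "j < length es" "?s Tail j = nu x" "?s Head j = ?s Dst i" for i j
  proof -
    have "es ! j = (x, dst i)"
      using that arc_code_iff[OF that(2) centre_in endpoints_in(2)[OF that(1)]]
      by (simp add: load_csa_input)
    then show ?thesis
      using that nth_arc[OF that(2)] arc_star[of x "dst i"]
      by (auto simp: load_csa_input b_def csa_b_def case_prod_beta)
  qed
  have B0: "\<exists>j<length es. ?s Tail j = nu x \<and> ?s Head j = ?s Dst i"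
    if i: "i < length T" and "b i \<noteq> 0" for i
  proof -
    have "(x, dst i) \<in> parcs G"
      using that walk_arcs(2)[OF i] by (auto simp: b_def csa_b_def case_prod_beta split: if_splits)
    from arc_nth[OF this] obtain j where "j < length es" "es ! j = (x, dst i)" by blast
    with i show ?thesis by (auto simp: load_csa_input intro!: exI[of _ j])
  qed
  have zero: "?s A i = 0 \<and> ?s B i = 0" if "i < length T" for i by (simp add: load_csa_input)
  note facts = load_csa_input(1-3) zero load_csa_input(11) A A0 B B0
  show "ok (\<lambda>t. \<exists>X d. (csa_step a b)\<^sup>*\<^sup>* ({..<length T}, {}, \<lambda>_. 0) ({}, X, d) \<and> stored d t)
           (csa_nsteps (length es) (length T)) csa_prog (load inp)"
    unfolding stored_def by (rule csa_prog_ok_can(1)) (fact facts)+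
  show "can (stored d) csa_prog (load inp)"
    if run: "(csa_step a b)\<^sup>*\<^sup>* ({..<length T}, {}, \<lambda>_. 0) ({}, X, d)"
    unfolding stored_def[abs_def]
    by (rule csa_prog_ok_can(2)[OF _ _ _ _ _ _ _ _ _ run]) (fact facts)+
qed

text \<open>One inclusion is soundness, from \<open>ok\<close> for every finished run; the other is
  that each way of breaking ties is realised, from \<open>can\<close>.\<close>

lemma csa_prog_outputs:
  "{read_output (length T) s | n s. steps (csa_prog, load inp) n (Skip, s)}
     = map (map_prod id (map nu)) ` csa_outputs lam T x" (is "?L = ?R")
proof (intro equalityI subsetI)
  fix out assume "out \<in> ?L"
  then obtain n t where t: "out = read_output (length T) t" "steps (csa_prog, load inp) n (Skip, t)"
    by blast
  from ok_final[OF csa_prog_run(1) t(2)] obtain X d where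
    "(csa_step (csa_a lam T x) (csa_b lam T x))\<^sup>*\<^sup>* ({..<length T}, {}, \<lambda>_. 0) ({}, X, d)" "stored d t"
    by blast
  then show "out \<in> ?R"
    unfolding t(1) csa_outputs_def by (subst read_output_stored) blast+
next
  fix out assume "out \<in> ?R"
  then obtain X d where
    out: "out = map (map_prod id (map nu)) (map (\<lambda>i. (d i, csa_walk T x i)) [0..<length T])"
    and run: "(csa_step (csa_a lam T x) (csa_b lam T x))\<^sup>*\<^sup>* ({..<length T}, {}, \<lambda>_. 0) ({}, X, d)"
    unfolding csa_outputs_def by blast
  from csa_prog_run(2)[OF run] obtain t where
    t: "stp\<^sup>*\<^sup>* (csa_prog, load inp) (Skip, t)" "stored d t" by (auto simp: can_def)
  from t(1) obtain n where "steps (csa_prog, load inp) n (Skip, t)" using steps_iff_stps by blast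
  moreover have "out = read_output (length T) t" using out read_output_stored[OF t(2)] by simp
  ultimately show "out \<in> ?L" by blast
qed

text \<open>Both counts are at most \<open>L\<close>, so by monotonicity the step bound can be taken
  at \<open>L\<close> in both arguments and depends on one variable.\<close>

lemma csa_prog_cost:
  assumes "steps (csa_prog, load inp) n (c, s)"
  defines "L \<equiv> input_size inp" and "g \<equiv> max_exp_size csa_prog"
  shows "n \<le> csa_nsteps L L * (1 + g * (L + csa_nsteps L L * g + g + 2))"
proof -
  have "length es = length (map lam es)" by simp
  also have "\<dots> \<le> L"
    unfolding L_def by (rule length_le_input_size[of Len]) (simp add: csa_input_def)
  finally have es: "length es \<le> L" .
  have "length T = length (map (nu \<circ> fst) T)" by simp
  also have "\<dots> \<le> L"
    unfolding L_def by (rule length_le_input_size[of Src]) (simp add: csa_input_def)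
  finally have "length T \<le> L" .
  then have "ok (\<lambda>_. True) (csa_nsteps L L) csa_prog (load inp)"
    using es by (intro ok_mono[OF csa_prog_run(1)] csa_nsteps_mono) auto
  then show ?thesis
    by (rule steps_cost_le[OF _ _ _ assms(1)]) (simp_all add: g_def L_def load_le)
qed

end

end

theorem theorem3p4:
  shows
    "(\<exists>p :: nat poly. \<forall>(G :: 'v pair_pre_digraph) lam T x nu es.
        star_instance G lam T x \<longrightarrow> encoding G nu es \<longrightarrow>
          (\<forall>n c s. steps (csa_prog, load (csa_input lam T x nu es)) n (c, s) \<longrightarrow>
             n \<le> poly p (input_size (csa_input lam T x nu es))) \<and>
          {read_output (length T) s | n s.
             steps (csa_prog, load (csa_input lam T x nu es)) n (Skip, s)}
            = map (map_prod id (map nu)) ` csa_outputs lam T x) \<and>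
     (\<forall>(G :: 'v pair_pre_digraph) lam T x.
        star_instance G lam T x \<longrightarrow>
          csa_outputs lam T x \<noteq> {} \<and>
          (\<forall>sol \<in> csa_outputs lam T x. feasible G lam T sol \<and> minmax_optimal G lam T sol))"
proof (intro conjI)
  obtain q :: "nat poly" where q: "\<And>L. poly q L = csa_nsteps L L"
    using csa_nsteps_poly by blast
  define g where "g = max_exp_size csa_prog"
  \<comment> \<open>The bound of \<open>csa_prog_cost\<close> with \<open>[:0, 1:]\<close> for the
    input size. Since \<open>g\<close> depends on the fixed program only, it enters as a
    constant.\<close>
  define p where "p = q * (1 + [:g:] * ([:0, 1:] + q * [:g:] + [:g:] + 2))"
  have p: "poly p L = csa_nsteps L L * (1 + g * (L + csa_nsteps L L * g + g + 2))" for L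
    by (simp add: p_def q algebra_simps)
  show "\<exists>p :: nat poly. \<forall>(G :: 'v pair_pre_digraph) lam T x nu es.
        star_instance G lam T x \<longrightarrow> encoding G nu es \<longrightarrow>
          (\<forall>n c s. steps (csa_prog, load (csa_input lam T x nu es)) n (c, s) \<longrightarrow>
             n \<le> poly p (input_size (csa_input lam T x nu es))) \<and>
          {read_output (length T) s | n s.
             steps (csa_prog, load (csa_input lam T x nu es)) n (Skip, s)}
            = map (map_prod id (map nu)) ` csa_outputs lam T x"
  proof (intro exI[of _ p] allI impI conjI)
    fix G :: "'v pair_pre_digraph" and lam T x nu es
    assume star: "star_instance G lam T x" and enc: "encoding G nu es"
    show "n \<le> poly p (input_size (csa_input lam T x nu es))"
      if "steps (csa_prog, load (csa_input lam T x nu es)) n (c, s)" for n c s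
      unfolding p g_def by (rule star_instance.csa_prog_cost[OF star enc that])
    show "{read_output (length T) s | n s. steps (csa_prog, load (csa_input lam T x nu es)) n (Skip, s)}
        = map (map_prod id (map nu)) ` csa_outputs lam T x"
      by (rule star_instance.csa_prog_outputs[OF star enc])
  qed
  show "\<forall>(G :: 'v pair_pre_digraph) lam T x.
        star_instance G lam T x \<longrightarrow>
          csa_outputs lam T x \<noteq> {} \<and>
          (\<forall>sol \<in> csa_outputs lam T x. feasible G lam T sol \<and> minmax_optimal G lam T sol)"
    using star_instance.csa_outputs_nonempty star_instance.csa_outputs_optimal minmax_optimal_def
    by metis
qed

end
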